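(* Let $d\ge1$, let $(M,g)$ be a $d$-dimensional smooth compact Riemannian manifold without boundary, and let $P=\Delta^{\alpha/2}$ with $\alpha\in(0,\infty)\setminus\{1\}$ or $P=\sqrt{m^2+\Delta}$ with $m\ge0$. Let $p,q\ge2$, $\sigma\in\mathbb{R}$, $\beta\in(0,\infty]$, and let $I\subset\mathbb{R}$ be a bounded interval of positive length. Suppose there is a constant $C$ such that for all $N\ge10$ $$\Big\|\sum_j\nu_j|e^{itP}f_j|^2\Big\|_{L^{p/2}_tL^{q/2}_x(I\times M)}\le C\,|I|^{\frac2p}N^{\sigma}\|\nu\|_{\ell^\beta}$$ holds for all orthonormal systems $(f_j)_j$ in $L^2(M)$ with $\operatorname{supp}\hat f_j\subset\{k:\lambda_k\le N\}$ and all sequences $\nu=(\nu_j)_j\in\ell^\beta$. Then $$\frac1\beta\ge1-\frac\sigma d.$$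
   Context: $\Delta=-\Delta_g$ is the nonnegative Laplace–Beltrami operator on $M$. $(e_k)_k$ is a fixed orthonormal basis of $L^2(M)$ of eigenfunctions, $\sqrt\Delta\, e_k=\lambda_k e_k$, with $0=\lambda_0<\lambda_1\le\lambda_2\le\dots$ counted with multiplicity. For $f\in L^2(M)$, $\hat f(k)=\langle f,e_k\rangle$; $e^{itP}$ is defined by the spectral theorem, i.e. $e^{itP}f=\sum_k e^{it\lambda_k^\alpha}\hat f(k)e_k$ or $\sum_k e^{it\sqrt{m^2+\lambda_k^2}}\hat f(k)e_k$ respectively. Mixed norms: $\|F\|_{L^a_tL^b_x(I\times M)}=\big\|\,\|F(t,\cdot)\|_{L^b(M)}\big\|_{L^a(I)}$. *)

theory Defs
  imports "HOL-Analysis.Analysis" "HOL-Probability.Essential_Supremum"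
begin

section \<open>Smooth functions on open subsets of Euclidean space\<close>

primrec C_k_on :: "nat \<Rightarrow> 'a::real_normed_vector set \<Rightarrow> ('a \<Rightarrow> 'b::real_normed_vector) \<Rightarrow> bool"
  where
    "C_k_on 0 S f \<longleftrightarrow> continuous_on S f"
  | "C_k_on (Suc k) S f \<longleftrightarrow>
       (\<forall>x\<in>S. f differentiable (at x)) \<and> (\<forall>v. C_k_on k S (\<lambda>x. frechet_derivative f (at x) v))"

definition smooth_on :: "'a::real_normed_vector set \<Rightarrow> ('a \<Rightarrow> 'b::real_normed_vector) \<Rightarrow> bool"
  where "smooth_on S f \<longleftrightarrow> (\<forall>k. C_k_on k S f)"

definition partial_deriv :: "'n \<Rightarrow> (real^'n \<Rightarrow> 'b::real_normed_vector) \<Rightarrow> real^'n \<Rightarrow> 'b"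
  where "partial_deriv i h y = frechet_derivative h (at y) (axis i 1)"


section \<open>Compact Riemannian manifolds\<close>

text \<open>A chart is a pair \<open>(U, \<phi>)\<close> of a domain and a coordinate map; \<open>\<phi>\<close> is only relevant on \<open>U\<close>.
  The dimension of the manifold is \<open>CARD('n)\<close>.\<close>

type_synonym ('a, 'n) chart = "'a set \<times> ('a \<Rightarrow> real^'n)"

definition chart_inv :: "('a, 'n) chart \<Rightarrow> real^'n \<Rightarrow> 'a"
  where "chart_inv c = inv_into (fst c) (snd c)"

definition is_chart :: "'a topology \<Rightarrow> ('a, 'n::finite) chart \<Rightarrow> bool"
  where "is_chart X c \<longleftrightarrow>
     openin X (fst c) \<and> open (snd c ` fst c) \<and>
     homeomorphic_map (subtopology X (fst c)) (top_of_set (snd c ` fst c)) (snd c)"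

definition transition :: "('a, 'n) chart \<Rightarrow> ('a, 'n) chart \<Rightarrow> real^'n \<Rightarrow> real^'n"
  where "transition c c' = snd c' \<circ> chart_inv c"

definition smooth_atlas :: "'a topology \<Rightarrow> ('a, 'n::finite) chart set \<Rightarrow> bool"
  where "smooth_atlas X A \<longleftrightarrow>
     (\<forall>c\<in>A. is_chart X c) \<and> (\<Union>c\<in>A. fst c) = topspace X \<and>
     (\<forall>c\<in>A. \<forall>c'\<in>A. smooth_on (snd c ` (fst c \<inter> fst c')) (transition c c'))"

text \<open>Second countability is automatic for a compact space covered by charts.\<close>

definition compact_smooth_manifold :: "'a topology \<Rightarrow> ('a, 'n::finite) chart set \<Rightarrow> bool"
  where "compact_smooth_manifold X A \<longleftrightarrow> compact_space X \<and> Hausdorff_space X \<and> smooth_atlas X A"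

definition smooth_fun :: "('a, 'n::finite) chart set \<Rightarrow> ('a \<Rightarrow> 'b::real_normed_vector) \<Rightarrow> bool"
  where "smooth_fun A f \<longleftrightarrow> (\<forall>c\<in>A. smooth_on (snd c ` fst c) (f \<circ> chart_inv c))"

text \<open>\<open>g c x\<close> is the matrix \<open>(g\<^sub>i\<^sub>j(x))\<close> of the metric at the point \<open>x\<close> in the coordinates of the
  chart \<open>c\<close>. The last clause is the transformation law of a covariant 2-tensor.\<close>

definition riemannian_metric ::
    "('a, 'n::finite) chart set \<Rightarrow> (('a, 'n) chart \<Rightarrow> 'a \<Rightarrow> real^'n^'n) \<Rightarrow> bool"
  where "riemannian_metric A g \<longleftrightarrow>
     (\<forall>c\<in>A. smooth_on (snd c ` fst c) (g c \<circ> chart_inv c)) \<and>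
     (\<forall>c\<in>A. \<forall>x\<in>fst c. transpose (g c x) = g c x \<and> (\<forall>v. v \<noteq> 0 \<longrightarrow> 0 < v \<bullet> (g c x *v v))) \<and>
     (\<forall>c\<in>A. \<forall>c'\<in>A. \<forall>x\<in>fst c \<inter> fst c'.
        let J = matrix (frechet_derivative (transition c c') (at (snd c x)))
        in g c x = transpose J ** g c' x ** J)"

text \<open>The Riemannian volume is the Borel measure on \<open>X\<close> that has density
  \<open>sqrt (det (g\<^sub>i\<^sub>j))\<close> in every chart; since countably many charts cover \<open>X\<close>, this determines it.\<close>

definition riemannian_volume ::
    "'a topology \<Rightarrow> ('a, 'n::finite) chart set \<Rightarrow> (('a, 'n) chart \<Rightarrow> 'a \<Rightarrow> real^'n^'n) \<Rightarrow>
     'a measure \<Rightarrow> bool"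
  where "riemannian_volume X A g \<mu> \<longleftrightarrow>
     space \<mu> = topspace X \<and> sets \<mu> = sigma_sets (topspace X) {U. openin X U} \<and>
     (\<forall>c\<in>A. \<forall>B\<in>sets \<mu>. B \<subseteq> fst c \<longrightarrow>
        emeasure \<mu> B = (\<integral>\<^sup>+y\<in>snd c ` B. ennreal (sqrt (det (g c (chart_inv c y)))) \<partial>lborel))"

text \<open>The Laplace--Beltrami operator (nonpositive sign convention) in the coordinates of \<open>c\<close>,
  \<open>(det g)\<^sup>-\<^sup>1\<^sup>/\<^sup>2 \<Sum>\<^sub>i \<partial>\<^sub>i ((det g)\<^sup>1\<^sup>/\<^sup>2 \<Sum>\<^sub>j g\<^sup>i\<^sup>j \<partial>\<^sub>j f)\<close>.
  The value at a point is the same in every chart around it.\<close>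

definition laplace_beltrami ::
    "(('a, 'n::finite) chart \<Rightarrow> 'a \<Rightarrow> real^'n^'n) \<Rightarrow> ('a, 'n) chart \<Rightarrow> ('a \<Rightarrow> complex) \<Rightarrow> 'a \<Rightarrow> complex"
  where "laplace_beltrami g c f x =
     (let G = g c \<circ> chart_inv c; h = f \<circ> chart_inv c; w = (\<lambda>y. sqrt (det (G y))); y0 = snd c x
      in (\<Sum>i\<in>UNIV. partial_deriv i
            (\<lambda>y. w y *\<^sub>R (\<Sum>j\<in>UNIV. (matrix_inv (G y) $ i $ j) *\<^sub>R partial_deriv j h y)) y0)
         /\<^sub>R w y0)"


section \<open>Lebesgue norms\<close>

definition ennreal_powr :: "ennreal \<Rightarrow> real \<Rightarrow> ennreal"
  where "ennreal_powr x a = (if x = \<infinity> then \<infinity> else ennreal (enn2real x powr a))"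

text \<open>Exponents range over \<open>(0, \<infinity>]\<close>.\<close>

definition Lnorm :: "ereal \<Rightarrow> 'a measure \<Rightarrow> ('a \<Rightarrow> ennreal) \<Rightarrow> ennreal"
  where "Lnorm a M h =
     (if a = \<infinity> then esssup M h
      else ennreal_powr (\<integral>\<^sup>+x. ennreal_powr (h x) (real_of_ereal a) \<partial>M) (1 / real_of_ereal a))"

definition mixed_norm ::
    "ereal \<Rightarrow> ereal \<Rightarrow> real set \<Rightarrow> 'a measure \<Rightarrow> (real \<Rightarrow> 'a \<Rightarrow> complex) \<Rightarrow> ennreal"
  where "mixed_norm a b I \<mu> F =
     Lnorm a (restrict_space lborel I) (\<lambda>t. Lnorm b \<mu> (\<lambda>x. ennreal (cmod (F t x))))"

definition ell_norm :: "ereal \<Rightarrow> nat set \<Rightarrow> (nat \<Rightarrow> complex) \<Rightarrow> ennreal"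
  where "ell_norm b J \<nu> = Lnorm b (count_space J) (\<lambda>j. ennreal (cmod (\<nu> j)))"


section \<open>The Hilbert space \<open>L\<^sup>2\<close>\<close>

text \<open>Elements of \<open>L\<^sup>2\<close> are represented by functions; equality is equality almost everywhere.\<close>

definition L2 :: "'a measure \<Rightarrow> ('a \<Rightarrow> complex) set"
  where "L2 \<mu> = {f \<in> borel_measurable \<mu>. integrable \<mu> (\<lambda>x. (cmod (f x))\<^sup>2)}"

definition L2_inner :: "'a measure \<Rightarrow> ('a \<Rightarrow> complex) \<Rightarrow> ('a \<Rightarrow> complex) \<Rightarrow> complex"
  where "L2_inner \<mu> f h = (\<integral>x. f x * cnj (h x) \<partial>\<mu>)"

definition orthonormal_system :: "'a measure \<Rightarrow> 'i set \<Rightarrow> ('i \<Rightarrow> 'a \<Rightarrow> complex) \<Rightarrow> bool"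
  where "orthonormal_system \<mu> J f \<longleftrightarrow>
     (\<forall>j\<in>J. f j \<in> L2 \<mu>) \<and> (\<forall>i\<in>J. \<forall>j\<in>J. L2_inner \<mu> (f i) (f j) = (if i = j then 1 else 0))"

definition L2_sums :: "'a measure \<Rightarrow> (nat \<Rightarrow> 'a \<Rightarrow> complex) \<Rightarrow> ('a \<Rightarrow> complex) \<Rightarrow> bool"
  where "L2_sums \<mu> u s \<longleftrightarrow>
     s \<in> L2 \<mu> \<and> (\<lambda>n. Lnorm 2 \<mu> (\<lambda>x. ennreal (cmod (s x - (\<Sum>k<n. u k x))))) \<longlonglongrightarrow> 0"

definition fourier_coeff :: "'a measure \<Rightarrow> (nat \<Rightarrow> 'a \<Rightarrow> complex) \<Rightarrow> ('a \<Rightarrow> complex) \<Rightarrow> nat \<Rightarrow> complex"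
  where "fourier_coeff \<mu> e f k = L2_inner \<mu> f (e k)"

definition orthonormal_basis :: "'a measure \<Rightarrow> (nat \<Rightarrow> 'a \<Rightarrow> complex) \<Rightarrow> bool"
  where "orthonormal_basis \<mu> e \<longleftrightarrow>
     orthonormal_system \<mu> UNIV e \<and>
     (\<forall>f\<in>L2 \<mu>. L2_sums \<mu> (\<lambda>k x. fourier_coeff \<mu> e f k * e k x) f)"


section \<open>Spectral data and the propagator\<close>

text \<open>Since \<open>lam k \<ge> 0\<close>, the relation \<open>\<surd>\<Delta> e\<^sub>k = lam k e\<^sub>k\<close> reads \<open>-\<Delta>\<^sub>g e\<^sub>k = (lam k)\<^sup>2 e\<^sub>k\<close>.\<close>

definition eigenbasis ::
    "('a, 'n::finite) chart set \<Rightarrow> (('a, 'n) chart \<Rightarrow> 'a \<Rightarrow> real^'n^'n) \<Rightarrow> 'a measure \<Rightarrow>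
     (nat \<Rightarrow> 'a \<Rightarrow> complex) \<Rightarrow> (nat \<Rightarrow> real) \<Rightarrow> bool"
  where "eigenbasis A g \<mu> e lam \<longleftrightarrow>
     orthonormal_basis \<mu> e \<and>
     lam 0 = 0 \<and> 0 < lam 1 \<and> incseq lam \<and>
     (\<forall>k. smooth_fun A (e k) \<and>
        (\<forall>c\<in>A. \<forall>x\<in>fst c. - laplace_beltrami g c (e k) x = complex_of_real ((lam k)\<^sup>2) * e k x))"

text \<open>\<open>P = \<omega> (\<surd>\<Delta>)\<close> with \<open>\<omega> s = s\<^sup>\<alpha>\<close> or \<open>\<omega> s = \<surd>(m\<^sup>2 + s\<^sup>2)\<close>.\<close>

definition dispersion_symbol :: "(real \<Rightarrow> real) \<Rightarrow> bool"
  where "dispersion_symbol \<omega> \<longleftrightarrow>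
     (\<exists>\<alpha>. 0 < \<alpha> \<and> \<alpha> \<noteq> 1 \<and> \<omega> = (\<lambda>s. s powr \<alpha>)) \<or>
     (\<exists>m\<ge>0. \<omega> = (\<lambda>s. sqrt (m\<^sup>2 + s\<^sup>2)))"

text \<open>A representative of \<open>e\<^sup>i\<^sup>t\<^sup>P f\<close>; the sum converges in \<open>L\<^sup>2\<close>, not necessarily pointwise.\<close>

definition propagator ::
    "'a measure \<Rightarrow> (nat \<Rightarrow> 'a \<Rightarrow> complex) \<Rightarrow> (nat \<Rightarrow> real) \<Rightarrow> (real \<Rightarrow> real) \<Rightarrow> real \<Rightarrow>
     ('a \<Rightarrow> complex) \<Rightarrow> 'a \<Rightarrow> complex"
  where "propagator \<mu> e lam \<omega> t f =
     (SOME s. L2_sums \<mu> (\<lambda>k x. cis (t * \<omega> (lam k)) * fourier_coeff \<mu> e f k * e k x) s)"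

text \<open>The density \<open>\<Sum>\<^sub>j \<nu>\<^sub>j |e\<^sup>i\<^sup>t\<^sup>P f\<^sub>j|\<^sup>2\<close>.\<close>

definition total_density ::
    "'a measure \<Rightarrow> (nat \<Rightarrow> 'a \<Rightarrow> complex) \<Rightarrow> (nat \<Rightarrow> real) \<Rightarrow> (real \<Rightarrow> real) \<Rightarrow>
     nat set \<Rightarrow> (nat \<Rightarrow> complex) \<Rightarrow> (nat \<Rightarrow> 'a \<Rightarrow> complex) \<Rightarrow> real \<Rightarrow> 'a \<Rightarrow> complex"
  where "total_density \<mu> e lam \<omega> J \<nu> f t x =
     (\<Sum>\<^sub>\<infinity>j\<in>J. \<nu> j * complex_of_real ((cmod (propagator \<mu> e lam \<omega> t (f j) x))\<^sup>2))"

end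

theory Submission
  imports Defs
begin

text \<open>Apply the estimate to \<open>f\<^sub>j = e\<^sub>j\<close>, \<open>\<nu>\<^sub>j = 1\<close>, for \<open>j\<close> in a finite set \<open>F\<close> of frequencies at most \<open>N\<close>.
  Since \<open>|e\<^sup>i\<^sup>t\<^sup>P e\<^sub>j| = |e\<^sub>j|\<close>, the density does not depend on \<open>t\<close> and has total mass \<open>card F\<close>, so on a space
  of finite volume the estimate gives \<open>card F \<le> C N\<^sup>\<sigma> (card F)\<^sup>1\<^sup>/\<^sup>\<beta>\<close>. The claim follows from the lower half of Weyl's
  law, that there are at least a constant times \<open>N\<^sup>d\<close> frequencies up to \<open>N\<close>. To see this, place about \<open>N\<^sup>d\<close>
  disjointly supported bumps \<open>b\<close> at scale \<open>1/N\<close> in one chart. They satisfy \<open>\<parallel>\<Delta>b\<parallel> \<le> C N\<^sup>2 \<parallel>b\<parallel>\<close>, hence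
  have most of their mass on frequencies of order \<open>N\<close>, and being orthogonal they need as many
  eigenfunctions there.\<close>

subsection \<open>Orthonormal systems in \<open>L\<^sup>2\<close>\<close>

text \<open>Bumps are measured by \<open>||Delta b||\<close> and not by their Dirichlet energy
  because the eigenvalue equation is given pointwise in charts. One integration by parts against
  \<open>e k\<close> yields \<open>|<Delta b, e k>| = (lam k)^2 |<b, e k>|\<close>, and Bessel's
  inequality for \<open>Delta b\<close> then bounds the mass of \<open>b\<close> on frequencies
  above N by \<open>||Delta b||^2 / N^4\<close>. No quadratic form and no expansion of
  \<open>Delta b\<close> enters; completeness of the basis is used for \<open>b\<close> alone. Since
  \<open>b\<close> lives in one chart, the integration by parts is a statement about compactly
  supported functions on Euclidean space.

  The exponents p and q leave no trace: on a finite measure space L^(q/2) dominates L^1 up to a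
  constant, and a density constant in time produces the same factor \<open>|I|^(2/p)\<close> that
  stands on the right. With \<open>card F\<close> at least a constant times M^d and N proportional
  to M, what remains for 1/\<beta> at most 1 is
  \<open>M^(d (1 - 1/\<beta>)) \<le> C M^\<sigma>\<close> for all M, so the exponents must be
  ordered in the same way.\<close>

lemma L2_measurable: "f \<in> L2 \<mu> \<Longrightarrow> f \<in> borel_measurable \<mu>"
  by (simp add: L2_def)

lemma L2_integrable_mult:
  assumes "f \<in> L2 \<mu>" "h \<in> L2 \<mu>"
  shows "integrable \<mu> (\<lambda>x. f x * cnj (h x))"
proof (rule Bochner_Integration.integrable_bound)
  show "integrable \<mu> (\<lambda>x. (cmod (f x))\<^sup>2 + (cmod (h x))\<^sup>2)"
    using assms by (simp add: L2_def)
  show "(\<lambda>x. f x * cnj (h x)) \<in> borel_measurable \<mu>"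
    using assms[THEN L2_measurable]
    by (intro borel_measurable_times borel_measurable_continuous_on[of cnj h] continuous_on_cnj continuous_on_id)
  have "a * b \<le> a\<^sup>2 + b\<^sup>2" if "a \<ge> 0" "b \<ge> 0" for a b :: real
  proof -
    have "0 \<le> a * b" using that by simp
    with sum_squares_bound[of a b] show ?thesis by linarith
  qed
  then show "AE x in \<mu>. norm (f x * cnj (h x)) \<le> norm ((cmod (f x))\<^sup>2 + (cmod (h x))\<^sup>2)"
    by (auto simp: norm_mult)
qed

lemma L2_cmult:
  assumes "f \<in> L2 \<mu>"
  shows "(\<lambda>x. a * f x) \<in> L2 \<mu>"
  using assms by (auto simp: L2_def norm_mult power_mult_distrib)

lemma L2_add:
  assumes "f \<in> L2 \<mu>" "h \<in> L2 \<mu>"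
  shows "(\<lambda>x. f x + h x) \<in> L2 \<mu>"
proof -
  have m: "(\<lambda>x. f x + h x) \<in> borel_measurable \<mu>"
    using assms[THEN L2_measurable] by measurable
  have "integrable \<mu> (\<lambda>x. (cmod (f x + h x))\<^sup>2)"
  proof (rule Bochner_Integration.integrable_bound)
    show "integrable \<mu> (\<lambda>x. 2 * (cmod (f x))\<^sup>2 + 2 * (cmod (h x))\<^sup>2)"
      using assms by (simp add: L2_def)
    show "(\<lambda>x. (cmod (f x + h x))\<^sup>2) \<in> borel_measurable \<mu>"
      using m by measurable
    have "(cmod (a + b))\<^sup>2 \<le> 2 * (cmod a)\<^sup>2 + 2 * (cmod b)\<^sup>2" for a b
    proof -
      have "(cmod (a + b))\<^sup>2 \<le> (cmod a + cmod b)\<^sup>2"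
        by (intro power_mono norm_triangle_ineq) auto
      also have "\<dots> \<le> 2 * (cmod a)\<^sup>2 + 2 * (cmod b)\<^sup>2"
        using sum_squares_bound[of "cmod a" "cmod b"] by (simp add: power2_sum)
      finally show ?thesis .
    qed
    then show "AE x in \<mu>. norm ((cmod (f x + h x))\<^sup>2)
        \<le> norm (2 * (cmod (f x))\<^sup>2 + 2 * (cmod (h x))\<^sup>2)"
      by auto
  qed
  with m show ?thesis by (simp add: L2_def)
qed

lemma L2_diff:
  assumes "f \<in> L2 \<mu>" "h \<in> L2 \<mu>"
  shows "(\<lambda>x. f x - h x) \<in> L2 \<mu>"
  using L2_add[OF assms(1) L2_cmult[OF assms(2), of "-1"]] by simp

lemma L2_zero: "(\<lambda>x. 0) \<in> L2 \<mu>"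
  by (simp add: L2_def)

lemma L2_sum:
  assumes "\<And>k. k \<in> F \<Longrightarrow> u k \<in> L2 \<mu>"
  shows "(\<lambda>x. \<Sum>k\<in>F. u k x) \<in> L2 \<mu>"
  using assms
  by (induction F rule: infinite_finite_induct) (auto intro: L2_add L2_zero)

lemma L2_inner_cnj: "L2_inner \<mu> h f = cnj (L2_inner \<mu> f h)"
  unfolding L2_inner_def by (simp add: Bochner_Integration.integral_cnj[symmetric] mult.commute)

lemma L2_inner_diff:
  assumes "f \<in> L2 \<mu>" "h \<in> L2 \<mu>" "u \<in> L2 \<mu>"
  shows "L2_inner \<mu> (\<lambda>x. f x - h x) u = L2_inner \<mu> f u - L2_inner \<mu> h u"
  unfolding L2_inner_def
  using L2_integrable_mult[OF assms(1,3)] L2_integrable_mult[OF assms(2,3)]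
  by (simp add: left_diff_distrib)

lemma L2_inner_cmult: "L2_inner \<mu> (\<lambda>x. a * f x) u = a * L2_inner \<mu> f u"
  unfolding L2_inner_def by (simp add: mult.assoc)

lemma L2_inner_sum:
  assumes "\<And>k. k \<in> F \<Longrightarrow> u k \<in> L2 \<mu>" "f \<in> L2 \<mu>"
  shows "L2_inner \<mu> (\<lambda>x. \<Sum>k\<in>F. u k x) f = (\<Sum>k\<in>F. L2_inner \<mu> (u k) f)"
  unfolding L2_inner_def sum_distrib_right
  by (rule Bochner_Integration.integral_sum) (intro L2_integrable_mult assms)

lemma L2_inner_self: "L2_inner \<mu> f f = of_real (\<integral>x. (cmod (f x))\<^sup>2 \<partial>\<mu>)"
  unfolding L2_inner_def
  by (simp add: complex_norm_square[symmetric] integral_complex_of_real del: of_real_power)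

text \<open>Pythagoras: the residual r is orthogonal to each \<open>e k\<close>, hence to the
  projection S, so \<open><r,r> = <r,f> = <f,f> - <S,f>\<close>. It is kept as an equality because
  Bessel's inequality reads off the sign of the left side and Parseval's identity its limit.\<close>

lemma orthonormal_residual:
  assumes "finite F" "orthonormal_system \<mu> F e" "f \<in> L2 \<mu>"
  shows "(\<integral>x. (cmod (f x - (\<Sum>k\<in>F. L2_inner \<mu> f (e k) * e k x)))\<^sup>2 \<partial>\<mu>)
       = (\<integral>x. (cmod (f x))\<^sup>2 \<partial>\<mu>) - (\<Sum>k\<in>F. (cmod (L2_inner \<mu> f (e k)))\<^sup>2)"
proof -
  define S where "S = (\<lambda>x. \<Sum>k\<in>F. L2_inner \<mu> f (e k) * e k x)"
  define r where "r = (\<lambda>x. f x - S x)"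
  have e: "e k \<in> L2 \<mu>" if "k \<in> F" for k
    using assms(2) that by (simp add: orthonormal_system_def)
  have on: "L2_inner \<mu> (e i) (e j) = (if i = j then 1 else 0)" if "i \<in> F" "j \<in> F" for i j
    using assms(2) that by (simp add: orthonormal_system_def)
  have S: "S \<in> L2 \<mu>"
    unfolding S_def by (intro L2_sum L2_cmult e)
  have r: "r \<in> L2 \<mu>"
    unfolding r_def by (intro L2_diff assms S)
  have S_inner: "L2_inner \<mu> S u = (\<Sum>k\<in>F. L2_inner \<mu> f (e k) * L2_inner \<mu> (e k) u)"
    if "u \<in> L2 \<mu>" for u
    unfolding S_def using that by (subst L2_inner_sum) (auto intro: L2_cmult e simp: L2_inner_cmult)
  have re: "L2_inner \<mu> r (e k) = 0" if "k \<in> F" for k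
  proof -
    have "L2_inner \<mu> r (e k) = L2_inner \<mu> f (e k) - (\<Sum>j\<in>F. L2_inner \<mu> f (e j) * (if j = k then 1 else 0))"
      unfolding r_def using that on by (simp add: L2_inner_diff[OF assms(3) S] S_inner e)
    also have "\<dots> = 0"
      using that assms(1) by (simp add: if_distrib[of "\<lambda>z. _ * z"] cong: if_cong)
    finally show ?thesis .
  qed
  have "L2_inner \<mu> S r = 0"
    using re L2_inner_cnj[of \<mu> "e _" r] by (simp add: S_inner[OF r])
  then have Sr: "L2_inner \<mu> r S = 0"
    using L2_inner_cnj[of \<mu> r S] by simp
  have "L2_inner \<mu> r r = L2_inner \<mu> f r - L2_inner \<mu> S r"
    using L2_inner_diff[OF assms(3) S r] unfolding r_def[symmetric] .
  also have "\<dots> = cnj (L2_inner \<mu> r f)"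
    by (subst (1 2) L2_inner_cnj) (simp add: Sr)
  finally have "cnj (L2_inner \<mu> r r) = L2_inner \<mu> r f"
    by simp
  then have "L2_inner \<mu> r r = L2_inner \<mu> r f"
    by (subst L2_inner_cnj)
  also have "\<dots> = L2_inner \<mu> f f - L2_inner \<mu> S f"
    unfolding r_def by (rule L2_inner_diff[OF assms(3) S assms(3)])
  also have "L2_inner \<mu> S f = (\<Sum>k\<in>F. of_real ((cmod (L2_inner \<mu> f (e k)))\<^sup>2))"
    unfolding S_inner[OF assms(3)]
    by (intro sum.cong refl) (metis L2_inner_cnj complex_norm_square of_real_power)
  finally have "complex_of_real (\<integral>x. (cmod (r x))\<^sup>2 \<partial>\<mu>)
      = of_real ((\<integral>x. (cmod (f x))\<^sup>2 \<partial>\<mu>) - (\<Sum>k\<in>F. (cmod (L2_inner \<mu> f (e k)))\<^sup>2))"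
    by (simp add: L2_inner_self)
  then show ?thesis
    unfolding of_real_eq_iff r_def S_def .
qed

lemma Bessel_inequality:
  assumes "finite F" "orthonormal_system \<mu> F e" "f \<in> L2 \<mu>"
  shows "(\<Sum>k\<in>F. (cmod (L2_inner \<mu> f (e k)))\<^sup>2) \<le> (\<integral>x. (cmod (f x))\<^sup>2 \<partial>\<mu>)"
proof -
  have "0 \<le> (\<integral>x. (cmod (f x - (\<Sum>k\<in>F. L2_inner \<mu> f (e k) * e k x)))\<^sup>2 \<partial>\<mu>)"
    by simp
  then show ?thesis
    unfolding orthonormal_residual[OF assms] by simp
qed

text \<open>Links the extended-valued norm, in which convergence of expansions is defined, with the
  real integrals of the Hilbert space computations.\<close>

lemma Lnorm_2:
  assumes "f \<in> L2 \<mu>"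
  shows "Lnorm 2 \<mu> (\<lambda>x. ennreal (cmod (f x))) = ennreal (sqrt (\<integral>x. (cmod (f x))\<^sup>2 \<partial>\<mu>))"
proof -
  have "(\<integral>\<^sup>+x. ennreal_powr (ennreal (cmod (f x))) 2 \<partial>\<mu>) = (\<integral>\<^sup>+x. ennreal ((cmod (f x))\<^sup>2) \<partial>\<mu>)"
    by (intro nn_integral_cong) (simp add: ennreal_powr_def)
  also have "\<dots> = ennreal (\<integral>x. (cmod (f x))\<^sup>2 \<partial>\<mu>)"
    by (rule nn_integral_eq_integral) (use assms in \<open>auto simp: L2_def\<close>)
  finally show ?thesis
    by (simp add: Lnorm_def ennreal_powr_def powr_half_sqrt)
qed

text \<open>By the residual identity, convergence of the expansion in L^2 says precisely that the
  deficit in Bessel's inequality tends to 0.\<close>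

lemma Parseval_sums:
  assumes "orthonormal_basis \<mu> e" "f \<in> L2 \<mu>"
  shows "(\<lambda>k. (cmod (L2_inner \<mu> f (e k)))\<^sup>2) sums (\<integral>x. (cmod (f x))\<^sup>2 \<partial>\<mu>)"
proof -
  let ?r = "\<lambda>n. (\<integral>x. (cmod (f x))\<^sup>2 \<partial>\<mu>) - (\<Sum>k<n. (cmod (L2_inner \<mu> f (e k)))\<^sup>2)"
  have os: "orthonormal_system \<mu> {..<n} e" and eL: "e k \<in> L2 \<mu>" for n k
    using assms(1) by (auto simp: orthonormal_basis_def orthonormal_system_def)
  have nn: "0 \<le> ?r n" for n
    using Bessel_inequality[OF _ os assms(2), of n] by simp
  have "Lnorm 2 \<mu> (\<lambda>x. ennreal (cmod (f x - (\<Sum>k<n. L2_inner \<mu> f (e k) * e k x)))) = ennreal (sqrt (?r n))" for n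
    by (subst Lnorm_2) (auto simp: orthonormal_residual[OF _ os assms(2)]
        intro!: L2_diff L2_sum L2_cmult assms eL)
  moreover have "L2_sums \<mu> (\<lambda>k x. L2_inner \<mu> f (e k) * e k x) f"
    using assms by (auto simp: orthonormal_basis_def fourier_coeff_def)
  ultimately have "(\<lambda>n. ennreal (sqrt (?r n))) \<longlonglongrightarrow> ennreal 0"
    by (simp add: L2_sums_def)
  then have "(\<lambda>n. sqrt (?r n)) \<longlonglongrightarrow> 0"
    by (subst (asm) tendsto_ennreal_iff) (use nn in auto)
  then have "(\<lambda>n. (sqrt (?r n))\<^sup>2) \<longlonglongrightarrow> 0\<^sup>2"
    by (rule tendsto_power)
  then have "?r \<longlonglongrightarrow> 0"
    unfolding real_sqrt_pow2[OF nn] by simp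
  then have "(\<lambda>n. (\<integral>x. (cmod (f x))\<^sup>2 \<partial>\<mu>) - ?r n) \<longlonglongrightarrow> (\<integral>x. (cmod (f x))\<^sup>2 \<partial>\<mu>) - 0"
    by (intro tendsto_intros)
  then show ?thesis
    by (simp add: sums_def)
qed

text \<open>A variant of the min-max principle by traces: the test functions concentrate at least half of
  their mass on low frequencies, so by Bessel's inequality (with the roles of the two systems
  exchanged) there are at least half as many low frequencies as test functions.\<close>

lemma eigenvalue_count_lower_bound:
  assumes basis: "orthonormal_basis \<mu> e"
    and "finite Z" and b: "orthonormal_system \<mu> Z b"
    and D: "\<And>z. z \<in> Z \<Longrightarrow> D z \<in> L2 \<mu>"
    and eig: "\<And>z k. z \<in> Z \<Longrightarrow> cmod (L2_inner \<mu> (D z) (e k)) = (lam k)\<^sup>2 * cmod (L2_inner \<mu> (b z) (e k))"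
    and small: "\<And>z. z \<in> Z \<Longrightarrow> (\<integral>x. (cmod (D z x))\<^sup>2 \<partial>\<mu>) \<le> N ^ 4 / 4"
    and "N > 0"
  shows "\<exists>F. finite F \<and> (\<forall>k\<in>F. lam k \<le> N) \<and> real (card Z) \<le> 2 * real (card F)"
proof -
  have os: "orthonormal_system \<mu> F e" and eL: "e k \<in> L2 \<mu>" for F k
    using basis by (auto simp: orthonormal_basis_def orthonormal_system_def)
  have bL: "b z \<in> L2 \<mu>" if "z \<in> Z" for z
    using b that by (simp add: orthonormal_system_def)
  have norm_b: "(\<integral>x. (cmod (b z x))\<^sup>2 \<partial>\<mu>) = 1" if "z \<in> Z" for z
  proof -
    have "L2_inner \<mu> (b z) (b z) = 1"
      using b that by (simp add: orthonormal_system_def)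
    then show ?thesis by (simp add: L2_inner_self)
  qed
  have norm_e: "(\<integral>x. (cmod (e k x))\<^sup>2 \<partial>\<mu>) = 1" for k
  proof -
    have "L2_inner \<mu> (e k) (e k) = 1"
      using os[of UNIV] by (simp add: orthonormal_system_def)
    then show ?thesis by (simp add: L2_inner_self)
  qed
  have "\<forall>\<^sub>F n in sequentially. \<forall>z\<in>Z. 3/4 < (\<Sum>k<n. (cmod (L2_inner \<mu> (b z) (e k)))\<^sup>2)"
  proof (rule eventually_ball_finite[OF \<open>finite Z\<close>], rule ballI)
    fix z assume "z \<in> Z"
    then have "(\<lambda>n. \<Sum>k<n. (cmod (L2_inner \<mu> (b z) (e k)))\<^sup>2) \<longlonglongrightarrow> 1"
      using Parseval_sums[OF basis bL] norm_b by (simp add: sums_def)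
    then show "\<forall>\<^sub>F n in sequentially. 3/4 < (\<Sum>k<n. (cmod (L2_inner \<mu> (b z) (e k)))\<^sup>2)"
      by (rule order_tendstoD) simp
  qed
  \<comment> \<open>One cutoff serves the finitely many test functions, so all sums below are
    finite. A mass of at most 1/4 is lost beyond it and at most 1/4 at high frequencies, which
    leaves one half.\<close>
  then obtain n where n: "\<And>z. z \<in> Z \<Longrightarrow> 3/4 < (\<Sum>k<n. (cmod (L2_inner \<mu> (b z) (e k)))\<^sup>2)"
    by (auto simp: eventually_sequentially)
  define F where "F = {k. k < n \<and> lam k \<le> N}"
  have fin: "finite F"
    by (simp add: F_def)
  have half: "1/2 \<le> (\<Sum>k\<in>F. (cmod (L2_inner \<mu> (b z) (e k)))\<^sup>2)" if z: "z \<in> Z" for z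
  proof -
    let ?c = "\<lambda>k. (cmod (L2_inner \<mu> (b z) (e k)))\<^sup>2"
    \<comment> \<open>Chebyshev's inequality in frequency: off \<open>F\<close> one has
      \<open>lam k > N\<close>, and \<open>lam k ^ 4 * ?c k\<close> is the squared coefficient of
      \<open>D z\<close>.\<close>
    have "N ^ 4 * (\<Sum>k\<in>{..<n} - F. ?c k) \<le> (\<Sum>k\<in>{..<n} - F. (cmod (L2_inner \<mu> (D z) (e k)))\<^sup>2)"
      unfolding sum_distrib_left
    proof (rule sum_mono)
      fix k assume "k \<in> {..<n} - F"
      then have "N ^ 4 \<le> lam k ^ 4"
        using \<open>N > 0\<close> by (intro power_mono) (auto simp: F_def)
      then have "N ^ 4 * ?c k \<le> lam k ^ 4 * ?c k"
        by (rule mult_right_mono) simp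
      then show "N ^ 4 * ?c k \<le> (cmod (L2_inner \<mu> (D z) (e k)))\<^sup>2"
        by (simp add: eig[OF z] power_mult_distrib flip: power_mult)
    qed
    also have "\<dots> \<le> N ^ 4 / 4"
      using Bessel_inequality[OF _ os D[OF z], of "{..<n} - F"] small[OF z] by simp
    finally have "(\<Sum>k\<in>{..<n} - F. ?c k) \<le> 1/4"
      using \<open>N > 0\<close> by (simp add: field_simps)
    moreover have "(\<Sum>k<n. ?c k) = (\<Sum>k\<in>{..<n} - F. ?c k) + (\<Sum>k\<in>F. ?c k)"
      by (rule sum.subset_diff) (auto simp: F_def)
    ultimately show ?thesis
      using n[OF z] by linarith
  qed
  have "real (card Z) / 2 \<le> (\<Sum>z\<in>Z. \<Sum>k\<in>F. (cmod (L2_inner \<mu> (b z) (e k)))\<^sup>2)"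
    using sum_mono[of Z "\<lambda>_. 1/2", OF half] by simp
  also have "\<dots> = (\<Sum>k\<in>F. \<Sum>z\<in>Z. (cmod (L2_inner \<mu> (e k) (b z)))\<^sup>2)"
  proof -
    have "cmod (L2_inner \<mu> (e k) (b z)) = cmod (L2_inner \<mu> (b z) (e k))" for k z
      by (subst L2_inner_cnj) simp
    then show ?thesis by (subst sum.swap) simp
  qed
  also have "\<dots> \<le> (\<Sum>k\<in>F. 1)"
    using Bessel_inequality[OF \<open>finite Z\<close> b eL] norm_e by (intro sum_mono) simp
  finally show ?thesis
    using fin by (intro exI[of _ F]) (auto simp: F_def)
qed

subsection \<open>The estimate tested on eigenfunctions\<close>

lemma ennreal_powr_mono:
  assumes "x \<le> y" "0 \<le> a"
  shows "ennreal_powr x a \<le> ennreal_powr y a"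
proof (cases "y = \<infinity>")
  case False
  then have "x < \<infinity>" "y < \<infinity>"
    using assms(1) by (auto simp: less_top top_unique)
  then show ?thesis
    using assms by (auto simp: ennreal_powr_def intro!: ennreal_leI powr_mono2 enn2real_mono)
qed (simp add: ennreal_powr_def)

lemma ennreal_powr_ennreal: "0 \<le> r \<Longrightarrow> ennreal_powr (ennreal r) a = ennreal (r powr a)"
  by (simp add: ennreal_powr_def)

lemma Lnorm_cong_AE:
  assumes "AE x in M. f x = h x" "f \<in> borel_measurable M" "h \<in> borel_measurable M"
  shows "Lnorm a M f = Lnorm a M h"
proof -
  have "esssup M f = esssup M h"
    by (rule esssup_AE_cong[OF assms(2,3,1)])
  moreover have "(\<integral>\<^sup>+x. ennreal_powr (f x) r \<partial>M) = (\<integral>\<^sup>+x. ennreal_powr (h x) r \<partial>M)" for r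
    using assms(1) by (intro nn_integral_cong_AE) auto
  ultimately show ?thesis
    by (simp add: Lnorm_def)
qed

text \<open>A threshold argument in place of Hoelder's inequality: where \<rho> exceeds a, it is at
  most \<open>a powr (1 - s) * \<rho> powr s\<close>. For finite r this costs a factor 2 against the
  sharp constant. The constant is chosen before \<rho>, so that it can serve all sets of
  eigenfunctions at once.\<close>

lemma Lnorm_ge_L1:
  assumes "finite_measure \<mu>" "1 \<le> r"
  shows "\<exists>c>0. \<forall>\<rho>. integrable \<mu> \<rho> \<longrightarrow> (\<forall>x. 0 \<le> \<rho> x) \<longrightarrow>
    ennreal (c * (\<integral>x. \<rho> x \<partial>\<mu>)) \<le> Lnorm r \<mu> (\<lambda>x. ennreal (\<rho> x))"
proof -
  interpret finite_measure \<mu> by fact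
  define m where "m = measure \<mu> (space \<mu>)"
  have em: "emeasure \<mu> (space \<mu>) = ennreal m"
    by (simp add: m_def emeasure_eq_measure)
  show ?thesis
  proof (cases "m = 0")
    case True
    have "(\<integral>x. \<rho> x \<partial>\<mu>) = 0" for \<rho> :: "'a \<Rightarrow> real"
    proof -
      have "AE x in \<mu>. \<rho> x = 0"
        using True em by (intro AE_I'[of "space \<mu>"]) auto
      then show ?thesis by (rule integral_eq_zero_AE)
    qed
    then show ?thesis by (intro exI[of _ 1]) simp
  next
    case False
    then have m: "m > 0"
      by (simp add: m_def less_le)
    \<comment> \<open>The integral is first taken positive, so that the threshold a below is
      positive; for integral 0 the bound is trivial.\<close>
    have "\<exists>c>0. \<forall>\<rho>. integrable \<mu> \<rho> \<longrightarrow> (\<forall>x. 0 \<le> \<rho> x) \<longrightarrow> 0 < (\<integral>x. \<rho> x \<partial>\<mu>) \<longrightarrow>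
      ennreal (c * (\<integral>x. \<rho> x \<partial>\<mu>)) \<le> Lnorm r \<mu> (\<lambda>x. ennreal (\<rho> x))"
    proof (cases "r = \<infinity>")
      case True
      show ?thesis
      proof (intro exI[of _ "1 / m"] conjI allI impI)
        fix \<rho> :: "'a \<Rightarrow> real" assume \<rho>: "integrable \<mu> \<rho>" "\<forall>x. 0 \<le> \<rho> x"
        let ?e = "esssup \<mu> (\<lambda>x. ennreal (\<rho> x))"
        have "ennreal (\<integral>x. \<rho> x \<partial>\<mu>) = (\<integral>\<^sup>+x. ennreal (\<rho> x) \<partial>\<mu>)"
          using \<rho> by (intro nn_integral_eq_integral[symmetric]) auto
        also have "\<dots> \<le> (\<integral>\<^sup>+x. ?e \<partial>\<mu>)"
          by (intro nn_integral_mono_AE esssup_AE)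
        also have "\<dots> = ?e * ennreal m"
          by (simp add: em)
        finally have *: "ennreal (\<integral>x. \<rho> x \<partial>\<mu>) \<le> ?e * ennreal m" .
        have "ennreal (1 / m * (\<integral>x. \<rho> x \<partial>\<mu>)) = ennreal (\<integral>x. \<rho> x \<partial>\<mu>) * ennreal (1 / m)"
          using m \<rho> by (subst ennreal_mult[symmetric]) (auto simp: mult.commute)
        also have "\<dots> \<le> ?e * ennreal m * ennreal (1 / m)"
          by (intro mult_right_mono *) simp
        also have "\<dots> = ?e"
          using m by (simp add: mult.assoc flip: ennreal_mult)
        finally show "ennreal (1 / m * (\<integral>x. \<rho> x \<partial>\<mu>)) \<le> Lnorm r \<mu> (\<lambda>x. ennreal (\<rho> x))"
          using True by (simp add: Lnorm_def)
      qed (use m in auto)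
    next
      case False
      then obtain s where s: "r = ereal s" "s \<ge> 1"
        using assms(2) by (cases r) auto
      show ?thesis
      proof (intro exI[of _ "m powr (1 / s) / (2 * m)"] conjI allI impI)
        fix \<rho> :: "'a \<Rightarrow> real"
        assume \<rho>: "integrable \<mu> \<rho>" "\<forall>x. 0 \<le> \<rho> x" "0 < (\<integral>x. \<rho> x \<partial>\<mu>)"
        define S where "S = (\<integral>x. \<rho> x \<partial>\<mu>)"
        \<comment> \<open>Chosen with \<open>a * m = S / 2\<close>: the part of \<rho> below the
          threshold carries at most half of the integral.\<close>
        define a where "a = S / (2 * m)"
        have a: "a > 0"
          using \<rho>(3) m by (simp add: a_def S_def)
        define T where "T = (\<integral>\<^sup>+x. ennreal (\<rho> x powr s) \<partial>\<mu>)"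
        have L: "Lnorm r \<mu> (\<lambda>x. ennreal (\<rho> x)) = ennreal_powr T (1 / s)"
          unfolding Lnorm_def s T_def using \<rho>(2) by (simp add: ennreal_powr_ennreal)
        have pw: "\<rho> x \<le> a + a powr (1 - s) * \<rho> x powr s" for x
        proof (cases "\<rho> x \<le> a")
          case True
          have "0 \<le> a powr (1 - s) * \<rho> x powr s" by simp
          with True show ?thesis by linarith
        next
          case False
          then have "\<rho> x powr (1 - s) \<le> a powr (1 - s)"
            using s a by (intro powr_mono2') auto
          then have "\<rho> x powr (1 - s) * \<rho> x powr s \<le> a powr (1 - s) * \<rho> x powr s"
            by (rule mult_right_mono) simp
          moreover have "\<rho> x powr (1 - s) * \<rho> x powr s = \<rho> x"
            using False a by (simp flip: powr_add)
          ultimately show ?thesis using a by linarith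
        qed
        have "ennreal S = (\<integral>\<^sup>+x. ennreal (\<rho> x) \<partial>\<mu>)"
          unfolding S_def using \<rho> by (intro nn_integral_eq_integral[symmetric]) auto
        also have "\<dots> \<le> (\<integral>\<^sup>+x. ennreal a + ennreal (a powr (1 - s)) * ennreal (\<rho> x powr s) \<partial>\<mu>)"
          using pw a by (intro nn_integral_mono)
            (simp add: ennreal_mult[symmetric] ennreal_plus[symmetric] del: ennreal_plus)
        also have "\<dots> = ennreal a * ennreal m + ennreal (a powr (1 - s)) * T"
        proof -
          have [measurable]: "\<rho> \<in> borel_measurable \<mu>" using \<rho> by auto
          show ?thesis
            unfolding T_def
            by (subst nn_integral_add) (auto simp: em nn_integral_cmult)
        qed
        finally have *: "ennreal S \<le> ennreal a * ennreal m + ennreal (a powr (1 - s)) * T" .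
        \<comment> \<open>As \<open>S = 2 * (a * m)\<close>, the bound just obtained leaves
          \<open>a * m\<close> for the term with T; dividing by \<open>a powr (1 - s)\<close> gives
          the claim.\<close>
        have "ennreal (m * a powr s) \<le> T"
        proof (cases "T = \<infinity>")
          case False
          then obtain u where u: "T = ennreal u" "u \<ge> 0"
            by (cases T) auto
          have "S \<le> a * m + a powr (1 - s) * u"
            using * u a m
            by (simp add: ennreal_mult[symmetric] ennreal_plus[symmetric] del: ennreal_plus)
          moreover have "S = 2 * (a * m)"
            using m by (simp add: a_def)
          ultimately have "a * m \<le> a powr (1 - s) * u" by linarith
          then have "a powr (s - 1) * (a * m) \<le> a powr (s - 1) * (a powr (1 - s) * u)"
            by (intro mult_left_mono) auto
          moreover have "a powr (s - 1) * (a * m) = m * a powr s"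
            using a by (simp add: powr_diff)
          moreover have "a powr (s - 1) * (a powr (1 - s) * u) = u"
            using a by (simp flip: powr_add mult.assoc)
          ultimately show ?thesis
            unfolding u using u by (simp add: ennreal_leI)
        qed simp
        then have "ennreal_powr (ennreal (m * a powr s)) (1 / s) \<le> ennreal_powr T (1 / s)"
          using s by (intro ennreal_powr_mono) auto
        moreover have "(m * a powr s) powr (1 / s) = m powr (1 / s) / (2 * m) * S"
          using s m a by (simp add: powr_mult powr_powr) (simp add: a_def)
        ultimately show "ennreal (m powr (1 / s) / (2 * m) * (\<integral>x. \<rho> x \<partial>\<mu>)) \<le> Lnorm r \<mu> (\<lambda>x. ennreal (\<rho> x))"
          unfolding L using m by (simp add: ennreal_powr_ennreal S_def)
      qed (use m in auto)
    qed
    moreover have "0 \<le> (\<integral>x. \<rho> x \<partial>\<mu>)" if "\<forall>x. 0 \<le> \<rho> x" for \<rho> :: "'a \<Rightarrow> real"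
      using that by simp
    ultimately show ?thesis
      by (metis ennreal_0 mult_zero_right order_le_less zero_le)
  qed
qed

text \<open>Monotonicity of the integral and the almost everywhere bound by the essential supremum
  hold for every function \<open>h\<close>. Hence no measurability in time has to be shown for the
  inner norm of a density whose representative is chosen anew at each t.\<close>

lemma Lnorm_const_le:
  assumes "0 < measure M (space M)" "0 < a" "0 \<le> K" "\<And>t. ennreal K \<le> h t"
  shows "ennreal (K * measure M (space M) powr real_of_ereal (1 / a)) \<le> Lnorm a M h"
proof -
  let ?m = "measure M (space M)"
  \<comment> \<open>Positivity of \<open>measure\<close> includes finiteness, because an infinite
    measure is sent to 0 by \<open>enn2real\<close>.\<close>
  have em: "emeasure M (space M) = ennreal ?m"
    using assms(1) by (intro emeasure_eq_ennreal_measure) (auto simp: measure_def)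
  show ?thesis
  proof (cases "a = \<infinity>")
    case True
    have "ennreal K \<le> esssup M h"
    proof (rule ccontr)
      assume "\<not> ennreal K \<le> esssup M h"
      then have lt: "esssup M h < ennreal K" by simp
      have "AE t in M. h t \<le> esssup M h"
        by (rule esssup_AE)
      then have "AE t in M. False"
        using lt assms(4) by (elim eventually_mono) (meson leD order_trans)
      then have "emeasure M (space M) = 0"
        by (simp add: AE_iff_null null_sets_def)
      then show False
        using em assms(1) by simp
    qed
    \<comment> \<open>Here \<open>1 / \<infinity> = 0\<close>, and \<open>measure powr 0\<close> is
      1 since the measure is positive (\<open>0 powr 0\<close> would be 0).\<close>
    then show ?thesis
      using True assms(1) by (simp add: Lnorm_def zero_ereal_def[symmetric])
  next
    case False
    then obtain s where s: "a = ereal s" "s > 0"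
      using assms(2) by (cases a) auto
    have "ennreal (K powr s * ?m) = (\<integral>\<^sup>+t. ennreal (K powr s) \<partial>M)"
      by (simp add: em ennreal_mult)
    also have "\<dots> \<le> (\<integral>\<^sup>+t. ennreal_powr (h t) s \<partial>M)"
      using ennreal_powr_mono[OF assms(4), of s] s assms(3)
      by (intro nn_integral_mono) (simp add: ennreal_powr_ennreal)
    finally have "ennreal_powr (ennreal (K powr s * ?m)) (1 / s)
        \<le> ennreal_powr (\<integral>\<^sup>+t. ennreal_powr (h t) s \<partial>M) (1 / s)"
      using s by (intro ennreal_powr_mono) auto
    moreover have "(K powr s * ?m) powr (1 / s) = K * ?m powr (1 / s)"
      using s assms(3) by (simp add: powr_mult powr_powr)
    ultimately show ?thesis
      using s by (simp add: Lnorm_def ennreal_powr_ennreal one_ereal_def)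
  qed
qed

text \<open>The convention \<open>1 / \<infinity> = 0\<close> lets one formula cover the sup norm
  too: its value 1 is \<open>card F powr 0\<close>.\<close>

lemma ell_norm_one:
  assumes "finite F" "F \<noteq> {}" "0 < \<beta>"
  shows "ell_norm \<beta> F (\<lambda>_. 1) = ennreal (real (card F) powr real_of_ereal (1 / \<beta>))"
proof (cases "\<beta> = \<infinity>")
  case True
  have "esssup (count_space F) (\<lambda>_. 1 :: ennreal) = 1"
    using assms(1,2) by (intro esssup_const) auto
  then show ?thesis
    using True assms by (simp add: ell_norm_def Lnorm_def zero_ereal_def[symmetric])
next
  case False
  then obtain b where b: "\<beta> = ereal b" "b > 0"
    using assms(3) by (cases \<beta>) auto
  have "ennreal_powr 1 b = 1" for b
    by (simp add: ennreal_powr_def)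
  moreover have "emeasure (count_space F) F = ennreal (real (card F))"
    using assms(1) by (simp add: ennreal_of_nat_eq_real_of_nat)
  ultimately show ?thesis
    using b by (simp add: ell_norm_def Lnorm_def ennreal_powr_ennreal one_ereal_def)
qed

section \<open>The density of a family of eigenfunctions\<close>

lemma L2_norm_zero_AE:
  assumes "f \<in> L2 \<mu>" "Lnorm 2 \<mu> (\<lambda>x. ennreal (cmod (f x))) = 0"
  shows "AE x in \<mu>. f x = 0"
proof -
  have "(\<integral>x. (cmod (f x))\<^sup>2 \<partial>\<mu>) = 0"
    using assms(2) Lnorm_2[OF assms(1)] Bochner_Integration.integral_nonneg[of \<mu> "\<lambda>x. (cmod (f x))\<^sup>2"]
    by (intro antisym) (simp_all add: ennreal_eq_0_iff)
  then have "AE x in \<mu>. (cmod (f x))\<^sup>2 = 0"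
    by (subst (asm) integral_nonneg_eq_0_iff_AE) (use assms in \<open>auto simp: L2_def\<close>)
  then show ?thesis by simp
qed

text \<open>\<open>propagator\<close> is an arbitrary representative picked by \<open>SOME\<close>,
  so its modulus is known only almost everywhere. The partial sums of the defining series are
  constant from index j + 1 on, so every admissible limit differs from
  \<open>cis (t * \<omega> (lam j)) * e j\<close> by a function of norm 0.\<close>

lemma propagator_eigenfunction:
  assumes "orthonormal_system \<mu> UNIV e"
  shows "propagator \<mu> e lam \<omega> t (e j) \<in> L2 \<mu>"
    and "AE x in \<mu>. cmod (propagator \<mu> e lam \<omega> t (e j) x) = cmod (e j x)"
proof -
  define z where "z = cis (t * \<omega> (lam j))"
  let ?u = "\<lambda>k x. cis (t * \<omega> (lam k)) * fourier_coeff \<mu> e (e j) k * e k x"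
  have eL: "e k \<in> L2 \<mu>" for k
    using assms by (simp add: orthonormal_system_def)
  have coeff: "fourier_coeff \<mu> e (e j) k = (if k = j then 1 else 0)" for k
    using assms by (simp add: orthonormal_system_def fourier_coeff_def)
  have "?u k x = (if k = j then z * e j x else 0)" for k x
    by (simp add: coeff z_def)
  then have partial: "(\<Sum>k<n. ?u k x) = z * e j x" if "n > j" for n x
    using that by simp
  have lim: "(\<lambda>n. Lnorm 2 \<mu> (\<lambda>x. ennreal (cmod (s x - (\<Sum>k<n. ?u k x)))))
      \<longlonglongrightarrow> Lnorm 2 \<mu> (\<lambda>x. ennreal (cmod (s x - z * e j x)))" for s
    by (rule tendsto_eventually, rule eventually_mono[OF eventually_gt_at_top[of j]])
      (simp only: partial)
  have "L2_sums \<mu> ?u (\<lambda>x. z * e j x)"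
    using lim[of "\<lambda>x. z * e j x"] Lnorm_2[OF L2_zero[of \<mu>]] L2_cmult[OF eL]
    by (simp add: L2_sums_def)
  then have "L2_sums \<mu> ?u (propagator \<mu> e lam \<omega> t (e j))" (is "L2_sums _ _ ?s")
    unfolding propagator_def by (rule someI[of "L2_sums \<mu> ?u"])
  then have sL: "?s \<in> L2 \<mu>" and "(\<lambda>n. Lnorm 2 \<mu> (\<lambda>x. ennreal (cmod (?s x - (\<Sum>k<n. ?u k x))))) \<longlonglongrightarrow> 0"
    by (auto simp: L2_sums_def)
  then have "Lnorm 2 \<mu> (\<lambda>x. ennreal (cmod (?s x - z * e j x))) = 0"
    using lim LIMSEQ_unique by blast
  then have "AE x in \<mu>. ?s x - z * e j x = 0"
    by (intro L2_norm_zero_AE L2_diff sL L2_cmult eL)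
  then show "AE x in \<mu>. cmod (?s x) = cmod (e j x)"
    by (auto simp: norm_mult z_def elim!: eventually_mono)
  show "?s \<in> L2 \<mu>" by (rule sL)
qed

text \<open>The null set on which the moduli of \<open>e j\<close> and its evolution differ depends
  on t, but the inner norm ignores it. The lower bound thus holds at every single time, and the
  outer norm contributes the factor \<open>|I|^(2/p)\<close>.\<close>

lemma mixed_norm_eigenfunction_density:
  assumes "orthonormal_system \<mu> UNIV e" "finite_measure \<mu>"
    and "2 \<le> p" "2 \<le> q" "0 < measure lborel I"
  shows "\<exists>c>0. \<forall>F. finite F \<longrightarrow>
    ennreal (c * real (card F) * measure lborel I powr real_of_ereal (2 / p))
      \<le> mixed_norm (p / 2) (q / 2) I \<mu> (total_density \<mu> e lam \<omega> F (\<lambda>_. 1) e)"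
proof -
  have "1 \<le> q / 2"
    using assms(4) by (cases q) (auto simp: one_ereal_def numeral_eq_ereal)
  then obtain c where c: "c > 0" "\<And>\<rho>. integrable \<mu> \<rho> \<Longrightarrow> (\<forall>x. 0 \<le> \<rho> x) \<Longrightarrow>
      ennreal (c * (\<integral>x. \<rho> x \<partial>\<mu>)) \<le> Lnorm (q / 2) \<mu> (\<lambda>x. ennreal (\<rho> x))"
    using Lnorm_ge_L1[OF assms(2)] by blast
  have p: "0 < p / 2" "1 / (p / 2) = 2 / p"
    using assms(3) by (cases p; simp add: one_ereal_def numeral_eq_ereal)+
  \<comment> \<open>Sets outside the sigma-algebra have \<open>emeasure\<close> 0 by convention, so
    positive length forces measurability.\<close>
  have "I \<in> sets lborel"
    using assms(5) by (metis emeasure_notin_sets enn2real_0 less_irrefl measure_def)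
  then have mI: "measure (restrict_space lborel I) (space (restrict_space lborel I)) = measure lborel I"
    by (simp add: space_restrict_space measure_restrict_space)
  have eL: "e k \<in> L2 \<mu>" for k
    using assms(1) by (simp add: orthonormal_system_def)
  have "ennreal (c * real (card F) * measure lborel I powr real_of_ereal (2 / p))
      \<le> mixed_norm (p / 2) (q / 2) I \<mu> (total_density \<mu> e lam \<omega> F (\<lambda>_. 1) e)" if "finite F" for F
  proof -
    define \<rho> where "\<rho> = (\<lambda>x. \<Sum>j\<in>F. (cmod (e j x))\<^sup>2)"
    have \<rho>: "integrable \<mu> \<rho>" "\<forall>x. 0 \<le> \<rho> x"
      unfolding \<rho>_def using eL by (auto simp: L2_def intro!: sum_nonneg)
    have "(\<integral>x. (cmod (e j x))\<^sup>2 \<partial>\<mu>) = 1" for j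
    proof -
      have "L2_inner \<mu> (e j) (e j) = 1"
        using assms(1) by (simp add: orthonormal_system_def)
      then show ?thesis by (simp add: L2_inner_self)
    qed
    then have int\<rho>: "(\<integral>x. \<rho> x \<partial>\<mu>) = real (card F)"
      unfolding \<rho>_def using eL by (subst Bochner_Integration.integral_sum) (auto simp: L2_def)
    have "ennreal (c * real (card F)) \<le> Lnorm (q / 2) \<mu> (\<lambda>x. ennreal (cmod (total_density \<mu> e lam \<omega> F (\<lambda>_. 1) e t x)))"
      (is "_ \<le> Lnorm _ _ ?d") for t
    proof -
      note pr = propagator_eigenfunction[OF assms(1), of lam \<omega> t]
      have d: "?d = (\<lambda>x. ennreal (\<Sum>j\<in>F. (cmod (propagator \<mu> e lam \<omega> t (e j) x))\<^sup>2))"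
        using that by (simp add: total_density_def sum_nonneg flip: of_real_power of_real_sum)
      have "AE x in \<mu>. \<forall>j\<in>F. cmod (propagator \<mu> e lam \<omega> t (e j) x) = cmod (e j x)"
        using pr(2) that by (intro AE_finite_allI) auto
      then have "AE x in \<mu>. ?d x = ennreal (\<rho> x)"
        by (rule eventually_mono) (simp add: fun_cong[OF d] \<rho>_def)
      moreover have "?d \<in> borel_measurable \<mu>"
        unfolding d using pr(1)[THEN L2_measurable] by measurable
      moreover have "(\<lambda>x. ennreal (\<rho> x)) \<in> borel_measurable \<mu>"
        using \<rho>(1) by auto
      ultimately have "Lnorm (q / 2) \<mu> ?d = Lnorm (q / 2) \<mu> (\<lambda>x. ennreal (\<rho> x))"
        by (rule Lnorm_cong_AE)
      then show ?thesis
        using c(2)[OF \<rho>] int\<rho> by simp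
    qed
    then show ?thesis
      unfolding mixed_norm_def using Lnorm_const_le[of "restrict_space lborel I" "p / 2" "c * real (card F)"]
        p c(1) assms(5) by (simp add: mI)
  qed
  with c(1) show ?thesis by blast
qed

text \<open>Both sides carry the same positive time factor, which cancels; what is left is an
  inequality between real numbers whose constant depends on neither N nor F.\<close>

lemma test_eigenfunctions:
  assumes "orthonormal_system \<mu> UNIV e" "finite_measure \<mu>"
    and "2 \<le> p" "2 \<le> q" "0 < \<beta>" "0 < measure lborel I"
    and strichartz: "\<exists>C\<ge>0. \<forall>N\<ge>10::real. \<forall>(J :: nat set) (f :: nat \<Rightarrow> 'a \<Rightarrow> complex) (\<nu> :: nat \<Rightarrow> complex).
        orthonormal_system \<mu> J f \<longrightarrow>
        (\<forall>j\<in>J. {k. fourier_coeff \<mu> e (f j) k \<noteq> 0} \<subseteq> {k. lam k \<le> N}) \<longrightarrow>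
        ell_norm \<beta> J \<nu> < \<infinity> \<longrightarrow>
        mixed_norm (p / 2) (q / 2) I \<mu> (total_density \<mu> e lam \<omega> J \<nu> f)
          \<le> ennreal (C * measure lborel I powr real_of_ereal (2 / p) * N powr \<sigma>) * ell_norm \<beta> J \<nu>"
  shows "\<exists>C. \<forall>N\<ge>10. \<forall>F. finite F \<longrightarrow> F \<noteq> {} \<longrightarrow> (\<forall>k\<in>F. lam k \<le> N) \<longrightarrow>
    real (card F) \<le> C * N powr \<sigma> * real (card F) powr real_of_ereal (1 / \<beta>)"
proof -
  obtain c where c: "c > 0" "\<And>F. finite F \<Longrightarrow>
    ennreal (c * real (card F) * measure lborel I powr real_of_ereal (2 / p))
      \<le> mixed_norm (p / 2) (q / 2) I \<mu> (total_density \<mu> e lam \<omega> F (\<lambda>_. 1) e)"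
    using mixed_norm_eigenfunction_density[OF assms(1,2,3,4,6)] by blast
  obtain C where C: "C \<ge> 0" and bound: "\<And>N J f \<nu>. N \<ge> 10 \<Longrightarrow> orthonormal_system \<mu> J f \<Longrightarrow>
        (\<forall>j\<in>J. {k. fourier_coeff \<mu> e (f j) k \<noteq> 0} \<subseteq> {k. lam k \<le> N}) \<Longrightarrow>
        ell_norm \<beta> J \<nu> < \<infinity> \<Longrightarrow>
        mixed_norm (p / 2) (q / 2) I \<mu> (total_density \<mu> e lam \<omega> J \<nu> f)
          \<le> ennreal (C * measure lborel I powr real_of_ereal (2 / p) * N powr \<sigma>) * ell_norm \<beta> J \<nu>"
    using strichartz by blast
  have "real (card F) \<le> C / c * N powr \<sigma> * real (card F) powr real_of_ereal (1 / \<beta>)"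
    if N: "N \<ge> 10" and F: "finite F" "F \<noteq> {}" "\<forall>k\<in>F. lam k \<le> N" for N F
  proof -
    let ?i = "measure lborel I powr real_of_ereal (2 / p)"
    note one = ell_norm_one[OF F(1,2) assms(5)]
    have "orthonormal_system \<mu> F e"
      using assms(1) by (simp add: orthonormal_system_def)
    moreover have "\<forall>j\<in>F. {k. fourier_coeff \<mu> e (e j) k \<noteq> 0} \<subseteq> {k. lam k \<le> N}"
      using assms(1) F(3) by (auto simp: orthonormal_system_def fourier_coeff_def split: if_splits)
    ultimately have "mixed_norm (p / 2) (q / 2) I \<mu> (total_density \<mu> e lam \<omega> F (\<lambda>_. 1) e)
          \<le> ennreal (C * ?i * N powr \<sigma>) * ell_norm \<beta> F (\<lambda>_. 1)"
      using bound[OF N, of F e "\<lambda>_. 1"] one by simp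
    then have "ennreal (c * real (card F) * ?i)
        \<le> ennreal (C * ?i * N powr \<sigma>) * ennreal (real (card F) powr real_of_ereal (1 / \<beta>))"
      using c(2)[OF F(1)] order_trans unfolding one by blast
    then have "c * real (card F) * ?i \<le> C * ?i * N powr \<sigma> * real (card F) powr real_of_ereal (1 / \<beta>)"
      using C by (simp flip: ennreal_mult)
    then have "?i * (c * real (card F)) \<le> ?i * (C * N powr \<sigma> * real (card F) powr real_of_ereal (1 / \<beta>))"
      by (simp add: algebra_simps)
    then have "c * real (card F) \<le> C * N powr \<sigma> * real (card F) powr real_of_ereal (1 / \<beta>)"
      using assms(6) by (simp add: mult_le_cancel_left_pos)
    then show ?thesis
      using c(1) by (simp add: field_simps)
  qed
  then show ?thesis by blast
qed

text \<open>For \<open>\<beta> < 1\<close> the ground state alone forces \<open>\<sigma> \<ge> 0\<close>, which already exceeds the claim, so no upper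
  bound on the number of eigenvalues is needed.\<close>

lemma exponent_bound:
  assumes "n > 0" "0 < \<beta>" "lam 0 \<le> (0::real)"
    and test: "\<exists>C. \<forall>N\<ge>10. \<forall>F. finite F \<longrightarrow> F \<noteq> {} \<longrightarrow> (\<forall>k\<in>F. lam k \<le> N) \<longrightarrow>
      real (card F) \<le> C * N powr \<sigma> * real (card F) powr real_of_ereal (1 / \<beta>)"
    and weyl: "\<exists>K. \<forall>M\<ge>1. \<exists>F. finite F \<and> (\<forall>k\<in>F. lam k \<le> K * real M) \<and> real (M ^ n) \<le> 2 * real (card F)"
  shows "1 / \<beta> \<ge> ereal (1 - \<sigma> / real n)"
proof -
  define \<tau> where "\<tau> = real_of_ereal (1 / \<beta>)"
  have \<beta>: "1 / \<beta> = ereal \<tau>" "\<tau> \<ge> 0"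
    using assms(2) unfolding \<tau>_def by (cases \<beta>; simp add: one_ereal_def zero_ereal_def)+
  obtain C where C: "\<And>N F. N \<ge> 10 \<Longrightarrow> finite F \<Longrightarrow> F \<noteq> {} \<Longrightarrow> (\<forall>k\<in>F. lam k \<le> N) \<Longrightarrow>
      real (card F) \<le> C * N powr \<sigma> * real (card F) powr \<tau>"
    using test unfolding \<tau>_def by blast
  obtain K where K: "\<And>M. M \<ge> 1 \<Longrightarrow> \<exists>F. finite F \<and> (\<forall>k\<in>F. lam k \<le> K * real M) \<and> real (M ^ n) \<le> 2 * real (card F)"
    using weyl by blast
  \<comment> \<open>Both cases below end by reading off the sign of an exponent: a fixed positive
    number cannot stay below a negative power of M as M grows.\<close>
  have no_decay: "0 \<le> s" if "\<And>M::nat. M \<ge> 1 \<Longrightarrow> a \<le> D * real M powr s" "a > 0" for a D s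
  proof (rule ccontr)
    assume "\<not> 0 \<le> s"
    then have "((\<lambda>M::nat. D * real M powr s) \<longlongrightarrow> D * 0) sequentially"
      by (intro tendsto_intros tendsto_neg_powr filterlim_real_sequentially) auto
    then have "a \<le> D * 0"
      using that(1) by (rule tendsto_lowerbound[OF _ eventually_sequentiallyI[of 1]]) auto
    with that(2) show False by simp
  qed
  have "1 - \<sigma> / real n \<le> \<tau>"
  proof (cases "\<tau> \<le> 1")
    case True
    \<comment> \<open>The frequency level is \<open>L * real M\<close>: at least
      \<open>K * real M\<close> for the eigenvalue count, and at least 10 for the
      hypothesis.\<close>
    define L where "L = max K 10"
    have "(1/2) powr (1 - \<tau>) \<le> C * L powr \<sigma> * real M powr (\<sigma> - real n * (1 - \<tau>))" if M: "M \<ge> 1" for M :: nat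
    proof -
      obtain F where F: "finite F" "\<forall>k\<in>F. lam k \<le> K * real M" "real (M ^ n) \<le> 2 * real (card F)"
        using K[OF M] by blast
      have card: "real (card F) > 0"
        using F(3) M by (smt (verit) of_nat_0_less_iff zero_less_power less_le_trans zero_less_one)
      have "K * real M \<le> L * real M"
        by (rule mult_right_mono) (auto simp: L_def)
      then have "\<forall>k\<in>F. lam k \<le> L * real M"
        using F(2) by force
      moreover have "10 * 1 \<le> L * real M"
        using M by (intro mult_mono) (auto simp: L_def)
      ultimately have le: "real (card F) \<le> C * (L * real M) powr \<sigma> * real (card F) powr \<tau>"
        using C[of "L * real M" F] F(1) card by fastforce
      \<comment> \<open>This is where \<tau> at most 1 matters: a lower bound for
        \<open>card F\<close> passes to the power \<open>1 - \<tau>\<close> only if that exponent is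
        nonnegative.\<close>
      have "(real (M ^ n) / 2) powr (1 - \<tau>) \<le> real (card F) powr (1 - \<tau>)"
        using F(3) True by (intro powr_mono2) auto
      also have "\<dots> = real (card F) / real (card F) powr \<tau>"
        using card by (simp add: powr_diff)
      also have "\<dots> \<le> C * (L * real M) powr \<sigma>"
        using le card by (simp add: divide_le_eq)
      also have "(L * real M) powr \<sigma> = L powr \<sigma> * real M powr \<sigma>"
        by (simp add: powr_mult L_def)
      finally have "(real (M ^ n) / 2) powr (1 - \<tau>) \<le> C * (L powr \<sigma> * real M powr \<sigma>)" .
      moreover have "(real (M ^ n) / 2) powr (1 - \<tau>) = (1/2) powr (1 - \<tau>) * real M powr (real n * (1 - \<tau>))"
        using M by (simp add: powr_divide powr_powr flip: powr_realpow)
      ultimately have "(1/2) powr (1 - \<tau>) * real M powr (real n * (1 - \<tau>)) * real M powr (- (real n * (1 - \<tau>)))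
          \<le> C * (L powr \<sigma> * real M powr \<sigma>) * real M powr (- (real n * (1 - \<tau>)))"
        by (intro mult_right_mono) auto
      then show ?thesis
        using M by (simp add: mult.assoc flip: powr_add)
    qed
    then have "0 \<le> \<sigma> - real n * (1 - \<tau>)"
      by (rule no_decay) auto
    then show ?thesis
      using assms(1) by (simp add: field_simps)
  next
    case False
    \<comment> \<open>The single frequency 0 lies below every level, here
      \<open>10 * real M\<close>, and M may tend to infinity.\<close>
    have "1 \<le> C * 10 powr \<sigma> * real M powr \<sigma>" if "M \<ge> 1" for M :: nat
      using C[of "10 * real M" "{0}"] that assms(3) by (simp add: powr_mult mult.assoc)
    then have "0 \<le> \<sigma>"
      by (rule no_decay) auto
    with False show ?thesis
      by (smt (verit) divide_nonneg_nonneg of_nat_0_le_iff)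
  qed
  then show ?thesis
    by (simp add: \<beta>)
qed

subsection \<open>Green's identity for divergence-form operators\<close>

text \<open>Lets the closure rules below exhibit a derivative through \<open>has_derivative\<close>,
  while \<open>C_k_on\<close> itself speaks of \<open>frechet_derivative\<close>.\<close>

lemma C1I:
  assumes "\<And>x. x \<in> V \<Longrightarrow> (f has_derivative f' x) (at x)" "\<And>v. continuous_on V (\<lambda>x. f' x v)"
  shows "C_k_on (Suc 0) V f"
proof -
  have eq: "frechet_derivative f (at x) = f' x" if "x \<in> V" for x
    using frechet_derivative_at[OF assms(1)[OF that]] by simp
  have "continuous_on V (\<lambda>x. frechet_derivative f (at x) v)" for v
    using assms(2)[of v] by (simp add: eq cong: continuous_on_cong)
  then show ?thesis
    using assms(1) by (auto simp: differentiable_def)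
qed

lemma C1_has_derivative:
  "C_k_on (Suc 0) V f \<Longrightarrow> x \<in> V \<Longrightarrow> (f has_derivative frechet_derivative f (at x)) (at x)"
  by (simp add: frechet_derivative_works[symmetric])

lemma C1_continuous_derivative:
  "C_k_on (Suc 0) V f \<Longrightarrow> continuous_on V (\<lambda>x. frechet_derivative f (at x) v)"
  by simp

lemma C1_imp_continuous_on: "C_k_on (Suc 0) V f \<Longrightarrow> continuous_on V f"
  by (auto intro!: continuous_at_imp_continuous_on differentiable_imp_continuous_within)

lemma C1_cong:
  assumes "open V" "C_k_on (Suc 0) V f" "\<And>x. x \<in> V \<Longrightarrow> f x = h x"
  shows "C_k_on (Suc 0) V h"
proof (rule C1I)
  show "(h has_derivative frechet_derivative f (at x)) (at x)" if "x \<in> V" for x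
    using C1_has_derivative[OF assms(2) that] assms(1) that assms(3)
    by (rule has_derivative_transform_within_open)
qed (rule C1_continuous_derivative[OF assms(2)])

lemma C1_const: "C_k_on (Suc 0) V (\<lambda>x. c)"
  by (rule C1I[where f' = "\<lambda>_ _. 0"]) auto

lemma C1_add:
  assumes "C_k_on (Suc 0) V f" "C_k_on (Suc 0) V h"
  shows "C_k_on (Suc 0) V (\<lambda>x. f x + h x)"
  by (rule C1I, rule has_derivative_add)
    (use assms in \<open>auto intro: C1_has_derivative intro!: continuous_on_add\<close>)

lemma C1_sum:
  assumes "\<And>k. k \<in> F \<Longrightarrow> C_k_on (Suc 0) V (f k)"
  shows "C_k_on (Suc 0) V (\<lambda>x. \<Sum>k\<in>F. f k x)"
  using assms
  by (induction F rule: infinite_finite_induct) (auto intro: C1_add C1_const simp del: C_k_on.simps)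

lemma (in bounded_bilinear) C1:
  assumes "C_k_on (Suc 0) V f" "C_k_on (Suc 0) V h"
  shows "C_k_on (Suc 0) V (\<lambda>x. prod (f x) (h x))"
proof (rule C1I)
  show "((\<lambda>x. prod (f x) (h x)) has_derivative
      (\<lambda>v. prod (f x) (frechet_derivative h (at x) v) + prod (frechet_derivative f (at x) v) (h x))) (at x)"
    if "x \<in> V" for x
    by (rule FDERIV) (auto intro: C1_has_derivative assms that)
  show "continuous_on V (\<lambda>x. prod (f x) (frechet_derivative h (at x) v) + prod (frechet_derivative f (at x) v) (h x))" for v
    by (intro continuous_on_add continuous_on C1_continuous_derivative C1_imp_continuous_on assms)
qed

lemmas C1_mult = bounded_bilinear.C1[OF bounded_bilinear_mult]
lemmas C1_scaleR = bounded_bilinear.C1[OF bounded_bilinear_scaleR]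

lemma C1_prod:
  fixes f :: "'i \<Rightarrow> 'a::real_normed_vector \<Rightarrow> real"
  assumes "\<And>k. k \<in> F \<Longrightarrow> C_k_on (Suc 0) V (f k)"
  shows "C_k_on (Suc 0) V (\<lambda>x. \<Prod>k\<in>F. f k x)"
  using assms
  by (induction F rule: infinite_finite_induct) (auto intro: C1_mult C1_const simp del: C_k_on.simps)

lemma C1_bounded_linear:
  assumes "bounded_linear L" "C_k_on (Suc 0) V f"
  shows "C_k_on (Suc 0) V (\<lambda>x. L (f x))"
proof (rule C1I)
  show "((\<lambda>x. L (f x)) has_derivative (\<lambda>v. L (frechet_derivative f (at x) v))) (at x)" if "x \<in> V" for x
    by (intro bounded_linear.has_derivative[OF assms(1)] C1_has_derivative[OF assms(2) that])
  show "continuous_on V (\<lambda>x. L (frechet_derivative f (at x) v))" for v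
    by (intro bounded_linear.continuous_on[OF assms(1)] C1_continuous_derivative[OF assms(2)])
qed

lemma C1_compose_real:
  fixes f :: "'a::real_normed_vector \<Rightarrow> real" and h :: "real \<Rightarrow> real"
  assumes "C_k_on (Suc 0) V f" "f ` V \<subseteq> S"
    and "\<And>s. s \<in> S \<Longrightarrow> (h has_real_derivative h' s) (at s)" "continuous_on S h'"
  shows "C_k_on (Suc 0) V (\<lambda>x. h (f x))"
proof (rule C1I)
  show "((\<lambda>x. h (f x)) has_derivative (\<lambda>v. h' (f x) * frechet_derivative f (at x) v)) (at x)"
    if "x \<in> V" for x
  proof -
    have "(h has_derivative (*) (h' (f x))) (at (f x))"
      using assms(2,3) that by (auto simp: has_field_derivative_def)
    from has_derivative_compose[OF C1_has_derivative[OF assms(1) that] this]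
    show ?thesis .
  qed
  have "continuous_on V (\<lambda>x. h' (f x))"
    using continuous_on_compose2[OF assms(4) C1_imp_continuous_on[OF assms(1)] assms(2)] .
  then show "continuous_on V (\<lambda>x. h' (f x) * frechet_derivative f (at x) v)" for v
    by (intro continuous_on_mult C1_continuous_derivative assms(1))
qed

lemma C1_partial_deriv:
  assumes "C_k_on (Suc (Suc 0)) V f"
  shows "C_k_on (Suc 0) V (partial_deriv i f)"
  using assms unfolding partial_deriv_def by simp

lemma C2_imp_C1: "C_k_on (Suc (Suc 0)) V f \<Longrightarrow> C_k_on (Suc 0) V f"
  by (metis C1_imp_continuous_on C_k_on.simps)

section \<open>Determinants and inverses of matrix-valued functions\<close>

lemma C1_component:
  fixes G :: "'a::real_normed_vector \<Rightarrow> real^'n^'m"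
  assumes "C_k_on (Suc 0) V G"
  shows "C_k_on (Suc 0) V (\<lambda>x. G x $ i $ j)"
  by (intro C1_bounded_linear[OF _ assms] bounded_linear_compose[OF bounded_linear_vec_nth bounded_linear_vec_nth])

lemma C1_det:
  fixes G :: "'a::real_normed_vector \<Rightarrow> real^'n^'n"
  assumes "\<And>i j. C_k_on (Suc 0) V (\<lambda>x. G x $ i $ j)"
  shows "C_k_on (Suc 0) V (\<lambda>x. det (G x))"
  unfolding det_def by (intro C1_sum C1_mult C1_const C1_prod assms)

text \<open>\<open>matrix_inv\<close> is defined by a choice and says nothing about regularity.
  Cramer's rule turns its entries into quotients of polynomials in the entries of the matrix, from
  which differentiability of the inverse metric can be read off.\<close>

lemma matrix_inv_cramer:
  fixes M :: "real^'n^'n"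
  assumes "det M \<noteq> 0"
  shows "matrix_inv M $ i $ j = det (\<chi> r c. if c = i then axis j 1 $ r else M $ r $ c) / det M"
proof -
  have "M ** matrix_inv M = mat 1"
    using assms someI_ex[of "\<lambda>M'. M ** M' = mat 1 \<and> M' ** M = mat 1"]
    by (simp add: matrix_inv_def invertible_det_nz[symmetric] invertible_def)
  then have "M *v (matrix_inv M *v axis j 1) = axis j 1"
    by (simp add: matrix_vector_mul_assoc)
  then have "matrix_inv M *v axis j 1 = (\<chi> k. det (\<chi> r c. if c = k then axis j 1 $ r else M $ r $ c) / det M)"
    using cramer[OF assms] by blast
  then have "(matrix_inv M *v axis j 1) $ i = det (\<chi> r c. if c = i then axis j 1 $ r else M $ r $ c) / det M"
    by simp
  then show ?thesis
    by (simp add: matrix_vector_mult_basis column_def)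
qed

lemma C1_matrix_inv_component:
  fixes G :: "'a::real_normed_vector \<Rightarrow> real^'n^'n"
  assumes "open V" "\<And>i j. C_k_on (Suc 0) V (\<lambda>x. G x $ i $ j)" "\<And>x. x \<in> V \<Longrightarrow> det (G x) \<noteq> 0"
  shows "C_k_on (Suc 0) V (\<lambda>x. matrix_inv (G x) $ i $ j)"
proof (rule C1_cong[OF assms(1)])
  have "C_k_on (Suc 0) V (\<lambda>x. (\<chi> r c. if c = i then axis j 1 $ r else G x $ r $ c) $ r $ c)" for r c
    using assms(2) C1_const by (cases "c = i") (simp_all del: C_k_on.simps)
  moreover have "C_k_on (Suc 0) V (\<lambda>x. inverse (det (G x)))"
  proof (rule C1_compose_real[where f = "\<lambda>x. det (G x)" and h = inverse and S = "- {0}" and h' = "\<lambda>s. - (inverse s)\<^sup>2"])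
    show "(inverse has_real_derivative - (inverse s)\<^sup>2) (at s)" if "s \<in> - {0}" for s :: real
      using DERIV_inverse[of s UNIV] that by (simp add: numeral_2_eq_2)
    show "continuous_on (- {0}) (\<lambda>s::real. - (inverse s)\<^sup>2)"
      by (intro continuous_intros) auto
  qed (use assms(3) in \<open>auto intro!: C1_det assms(2) simp del: C_k_on.simps\<close>)
  ultimately show "C_k_on (Suc 0) V (\<lambda>x. det (\<chi> r c. if c = i then axis j 1 $ r else G x $ r $ c) * inverse (det (G x)))"
    by (intro C1_mult C1_det)
qed (simp add: matrix_inv_cramer assms(3) divide_inverse)

text \<open>A homotopy argument: every matrix on the segment from the identity to \<open>M\<close>
  is positive definite and hence has trivial kernel, so by the intermediate value theorem the
  determinant stays on the side of its initial value 1.\<close>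

lemma det_pos_of_positive_definite:
  fixes M :: "real^'n^'n"
  assumes "\<And>v. v \<noteq> 0 \<Longrightarrow> 0 < v \<bullet> (M *v v)"
  shows "0 < det M"
proof (rule ccontr)
  assume "\<not> 0 < det M"
  define P where "P = (\<lambda>t::real. t *\<^sub>R M + (1 - t) *\<^sub>R mat 1)"
  have "continuous_on {0..1} (\<lambda>t. det (P t))"
    unfolding P_def det_def by (intro continuous_intros)
  moreover have "det (P 0) = 1" "det (P 1) \<le> 0"
    using \<open>\<not> 0 < det M\<close> by (auto simp: P_def)
  ultimately obtain t where t: "0 \<le> t" "t \<le> 1" "det (P t) = 0"
    using IVT2'[of "\<lambda>t. det (P t)" 1 0 0] by auto
  then obtain v where v: "v \<noteq> 0" "P t *v v = 0"
    by (metis invertible_det_nz invertible_left_inverse matrix_left_invertible_ker)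
  then have "0 = v \<bullet> (P t *v v)"
    by simp
  also have "\<dots> = t * (v \<bullet> (M *v v)) + (1 - t) * (v \<bullet> v)"
  proof -
    have "(k *\<^sub>R B) *v v = k *\<^sub>R (B *v v)" for k and B :: "real^'n^'n"
      by (simp add: vec_eq_iff matrix_vector_mult_def sum_distrib_left mult.assoc)
    then show ?thesis
      unfolding P_def by (simp add: matrix_vector_mult_add_rdistrib inner_add_right)
  qed
  finally have *: "t * (v \<bullet> (M *v v)) + (1 - t) * (v \<bullet> v) = 0" ..
  have "0 < v \<bullet> v" "0 < v \<bullet> (M *v v)"
    using v(1) assms by auto
  then have "0 \<le> t * (v \<bullet> (M *v v))" "0 \<le> (1 - t) * (v \<bullet> v)"
    using t by auto
  with * have "t * (v \<bullet> (M *v v)) = 0" "(1 - t) * (v \<bullet> v) = 0"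
    by linarith+
  then show False
    using \<open>0 < v \<bullet> v\<close> \<open>0 < v \<bullet> (M *v v)\<close> by simp
qed

section \<open>Integration by parts for compactly supported functions\<close>

lemma integrable_compact_support:
  fixes f :: "real^'n \<Rightarrow> 'b::euclidean_space"
  assumes "compact K" "continuous_on K f" "\<And>y. y \<notin> K \<Longrightarrow> f y = 0"
  shows "integrable lborel f"
proof -
  have "(\<lambda>y. indicator K y *\<^sub>R f y) = f"
    using assms(3) by (auto simp: indicator_def)
  then show ?thesis
    using borel_integrable_compact[OF assms(1,2)] by simp
qed

text \<open>Regularity on \<open>V\<close> becomes differentiability everywhere: a point lies either
  in \<open>K\<close>, hence in \<open>V\<close>, or in the open complement of \<open>K\<close>,
  where \<open>E\<close> vanishes.\<close>

lemma has_derivative_compact_support: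
  fixes E :: "real^'n \<Rightarrow> 'b::real_normed_vector"
  assumes "compact K" "K \<subseteq> V" "C_k_on (Suc 0) V E" "\<And>y. y \<notin> K \<Longrightarrow> E y = 0"
  shows "(E has_derivative frechet_derivative E (at y)) (at y)"
    and "y \<notin> K \<Longrightarrow> frechet_derivative E (at y) = (\<lambda>_. 0)"
proof -
  have off: "(E has_derivative (\<lambda>_. 0)) (at y)" if "y \<notin> K"
    using has_derivative_const[of 0 "at y"] open_Compl[OF compact_imp_closed[OF assms(1)]]
    by (rule has_derivative_transform_within_open) (use that assms(4) in auto)
  then show *: "y \<notin> K \<Longrightarrow> frechet_derivative E (at y) = (\<lambda>_. 0)"
    by (rule frechet_derivative_at[symmetric])
  show "(E has_derivative frechet_derivative E (at y)) (at y)"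
    using off * C1_has_derivative[OF assms(3)] assms(2) by (cases "y \<in> K") auto
qed

text \<open>The difference quotients have integral zero by translation invariance and converge boundedly
  to the partial derivative.\<close>

lemma integral_partial_deriv_compact_support:
  fixes E :: "real^'n \<Rightarrow> 'b::euclidean_space"
  assumes "compact K" "K \<subseteq> V" "C_k_on (Suc 0) V E" "\<And>y. y \<notin> K \<Longrightarrow> E y = 0"
  shows "integrable lborel (partial_deriv i E)" and "(\<integral>y. partial_deriv i E y \<partial>lborel) = 0"
proof -
  define a :: "real^'n" where "a = axis i 1"
  define D where "D = partial_deriv i E"
  have deriv: "(E has_derivative frechet_derivative E (at y)) (at y)" for y
    by (rule has_derivative_compact_support(1)[OF assms])
  have D: "frechet_derivative E (at y) (s *\<^sub>R a) = s *\<^sub>R D y" for y s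
    using linear_cmul[OF has_derivative_linear[OF deriv]] by (simp add: D_def partial_deriv_def a_def)
  have D0: "D y = 0" if "y \<notin> K" for y
    using has_derivative_compact_support(2)[OF assms that] by (simp add: D_def partial_deriv_def)
  have Dc: "continuous_on K D"
    unfolding D_def partial_deriv_def
    by (rule continuous_on_subset[OF C1_continuous_derivative[OF assms(3)] assms(2)])
  show int: "integrable lborel (partial_deriv i E)"
    using integrable_compact_support[OF assms(1) Dc D0] unfolding D_def .
  have "bounded (D ` K)"
    by (intro compact_imp_bounded compact_continuous_image Dc assms(1))
  then obtain B where B: "B > 0" "\<forall>z\<in>D ` K. norm z \<le> B"
    unfolding bounded_pos by blast
  then have DB: "norm (D y) \<le> B" for y
    using D0[of y] by (cases "y \<in> K") auto
  have lip: "norm (E (y + h *\<^sub>R a) - E y) \<le> B * h" if "h \<ge> 0" for y h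
  proof -
    have "norm (E (y + h *\<^sub>R a) - E (y + 0 *\<^sub>R a)) \<le> B * norm (h - 0)"
    proof (rule differentiable_bound[of "{0..h}" "\<lambda>t. E (y + t *\<^sub>R a)" "\<lambda>t s. s *\<^sub>R D (y + t *\<^sub>R a)"])
      fix t assume "t \<in> {0..h}"
      have "((\<lambda>t. y + t *\<^sub>R a) has_derivative (\<lambda>s. s *\<^sub>R a)) (at t within {0..h})"
        by (auto intro!: derivative_eq_intros)
      from has_derivative_compose[OF this deriv]
      show "((\<lambda>t. E (y + t *\<^sub>R a)) has_derivative (\<lambda>s. s *\<^sub>R D (y + t *\<^sub>R a))) (at t within {0..h})"
        by (simp add: D)
      show "onorm (\<lambda>s. s *\<^sub>R D (y + t *\<^sub>R a)) \<le> B"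
        using DB by (intro onorm_le) (simp add: mult.commute[of B] mult_left_mono)
    qed (use that in auto)
    then show ?thesis using that by simp
  qed
  obtain R where R: "K \<subseteq> cball 0 R"
    using compact_imp_bounded[OF assms(1)] unfolding bounded_iff by (auto simp: subset_iff)
  define Q where "Q = (\<lambda>n y. real (Suc n) *\<^sub>R (E (y + (1 / real (Suc n)) *\<^sub>R a) - E y))"
  have Econt: "continuous_on S E" for S
    using deriv by (intro continuous_at_imp_continuous_on) (auto intro: has_derivative_continuous)
  have Em: "E \<in> borel_measurable borel"
    by (rule borel_measurable_continuous_onI[OF Econt])
  have Eint: "integrable lborel E"
    by (rule integrable_compact_support[OF assms(1) Econt assms(4)])
  have shift: "integrable lborel (\<lambda>y. E (y + c)) \<and> (\<integral>y. E (y + c) \<partial>lborel) = (\<integral>y. E y \<partial>lborel)" for c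
  proof -
    have "integrable (distr lborel borel ((+) c)) E"
      using Eint by (simp add: lborel_distr_plus)
    then have "integrable lborel (\<lambda>y. E (c + y))"
      by (subst (asm) integrable_distr_eq) (use Em in auto)
    moreover have "(\<integral>y. E y \<partial>distr lborel borel ((+) c)) = (\<integral>y. E (c + y) \<partial>lborel)"
      by (rule integral_distr) (use Em in auto)
    ultimately show ?thesis
      by (simp add: lborel_distr_plus add.commute)
  qed
  have Q0: "(\<integral>y. Q n y \<partial>lborel) = 0" for n
    unfolding Q_def using shift Eint by simp
  \<comment> \<open>The shifts have length at most 1, so all quotients vanish off the ball of radius
    R + 1; inside it the mean value bound \<open>lip\<close> dominates them by B.\<close>
  have "(\<lambda>n. \<integral>y. Q n y \<partial>lborel) \<longlonglongrightarrow> (\<integral>y. D y \<partial>lborel)"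
  proof (rule integral_dominated_convergence[where w = "\<lambda>y. indicator (cball 0 (R + 1)) y *\<^sub>R B"])
    show "D \<in> borel_measurable lborel"
      using int unfolding D_def by auto
    show "Q n \<in> borel_measurable lborel" for n
      unfolding Q_def using shift Eint by (intro borel_measurable_integrable) auto
    show "integrable lborel (\<lambda>y::real^'n. indicator (cball 0 (R + 1)) y *\<^sub>R B)"
      by (intro borel_integrable_compact) auto
    show "AE y in lborel. norm (Q n y) \<le> indicator (cball 0 (R + 1)) y *\<^sub>R B" for n
    proof (intro AE_I2)
      fix y :: "real^'n"
      let ?h = "1 / real (Suc n)"
      show "norm (Q n y) \<le> indicator (cball 0 (R + 1)) y *\<^sub>R B"
      proof (cases "y \<in> cball 0 (R + 1)")
        case True
        have "real (Suc n) * norm (E (y + ?h *\<^sub>R a) - E y) \<le> real (Suc n) * (B * ?h)"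
          by (intro mult_left_mono lip) auto
        then show ?thesis using True by (simp add: Q_def)
      next
        case False
        have h: "norm (?h *\<^sub>R a) \<le> 1"
          by (simp add: a_def norm_axis_1)
        then have "R < norm (y + ?h *\<^sub>R a)"
        proof -
          have "R + 1 < norm y" using False by simp
          with h norm_diff_ineq[of y "?h *\<^sub>R a"] show ?thesis by linarith
        qed
        then have "y + ?h *\<^sub>R a \<notin> K" "y \<notin> K"
          using R False by auto
        then show ?thesis using False by (simp add: Q_def assms(4))
      qed
    qed
    show "AE y in lborel. (\<lambda>n. Q n y) \<longlonglongrightarrow> D y"
    proof (intro AE_I2)
      fix y :: "real^'n"
      have "((\<lambda>t. y + t *\<^sub>R a) has_derivative (\<lambda>s. s *\<^sub>R a)) (at 0)"
        by (auto intro!: derivative_eq_intros)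
      from has_derivative_compose[OF this deriv[of "y + 0 *\<^sub>R a"]]
      have "((\<lambda>t. E (y + t *\<^sub>R a)) has_vector_derivative D y) (at 0)"
        by (simp add: D has_vector_derivative_def)
      then have "((\<lambda>h. norm (E (y + h *\<^sub>R a) - E y - h *\<^sub>R D y) / norm h) \<longlongrightarrow> 0) (at 0)"
        by (simp add: has_vector_derivative_def has_derivative_at)
      moreover have "norm ((1 / h) *\<^sub>R (E (y + h *\<^sub>R a) - E y) - D y)
          = norm (E (y + h *\<^sub>R a) - E y - h *\<^sub>R D y) / norm h" if "h \<noteq> 0" for h
      proof -
        have "(1 / h) *\<^sub>R (E (y + h *\<^sub>R a) - E y) - D y = (1 / h) *\<^sub>R (E (y + h *\<^sub>R a) - E y - h *\<^sub>R D y)"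
          using that by (simp add: scaleR_diff_right)
        then show ?thesis by simp
      qed
      ultimately have "((\<lambda>h. norm ((1 / h) *\<^sub>R (E (y + h *\<^sub>R a) - E y) - D y)) \<longlongrightarrow> 0) (at 0)"
        by (simp cong: Lim_cong_within)
      then have "((\<lambda>h. (1 / h) *\<^sub>R (E (y + h *\<^sub>R a) - E y)) \<longlongrightarrow> D y) (at 0)"
        by (rule Lim_null[THEN iffD2, OF tendsto_norm_zero_cancel])
      moreover have "filterlim (\<lambda>n. 1 / real (Suc n)) (at 0) sequentially"
        using LIMSEQ_inverse_real_of_nat by (simp add: filterlim_at inverse_eq_divide)
      ultimately have "(\<lambda>n. (1 / (1 / real (Suc n))) *\<^sub>R (E (y + (1 / real (Suc n)) *\<^sub>R a) - E y)) \<longlonglongrightarrow> D y"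
        by (rule filterlim_compose)
      then show "(\<lambda>n. Q n y) \<longlonglongrightarrow> D y"
        by (simp add: Q_def)
    qed
  qed
  then show "(\<integral>y. partial_deriv i E y \<partial>lborel) = 0"
    unfolding Q0 D_def using LIMSEQ_unique tendsto_const by metis
qed

text \<open>For \<open>A\<close> equal to sqrt(det g) times the inverse metric this is the
  Laplace-Beltrami operator without its outer factor (det g)^(-1/2). That factor cancels against the
  volume density, so symmetry becomes a statement about Lebesgue measure.\<close>

definition divergence_form :: "(real^'n \<Rightarrow> real^'n^'n) \<Rightarrow> (real^'n \<Rightarrow> 'b::real_normed_vector) \<Rightarrow> real^'n \<Rightarrow> 'b"
  where "divergence_form A h y = (\<Sum>i\<in>UNIV. partial_deriv i (\<lambda>y. \<Sum>j\<in>UNIV. A y $ i $ j *\<^sub>R partial_deriv j h y) y)"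

lemma partial_deriv_bilinear:
  assumes "bounded_bilinear pr" "f differentiable (at y)" "h differentiable (at y)"
  shows "partial_deriv i (\<lambda>y. pr (f y) (h y)) y = pr (f y) (partial_deriv i h y) + pr (partial_deriv i f y) (h y)"
  using frechet_derivative_at[OF bounded_bilinear.FDERIV[OF assms(1)
        frechet_derivative_works[THEN iffD1, OF assms(2)] frechet_derivative_works[THEN iffD1, OF assms(3)]]]
  unfolding partial_deriv_def by metis

lemma partial_deriv_diff:
  assumes "f differentiable (at y)" "h differentiable (at y)"
  shows "partial_deriv i (\<lambda>y. f y - h y) y = partial_deriv i f y - partial_deriv i h y"
  using frechet_derivative_at[OF has_derivative_diff[OF
        frechet_derivative_works[THEN iffD1, OF assms(1)] frechet_derivative_works[THEN iffD1, OF assms(2)]]]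
  unfolding partial_deriv_def by metis

lemma C1_divergence_form_flux:
  fixes A :: "real^'n \<Rightarrow> real^'n^'n"
  assumes "\<And>i j. C_k_on (Suc 0) V (\<lambda>y. A y $ i $ j)" "C_k_on (Suc (Suc 0)) V h"
  shows "C_k_on (Suc 0) V (\<lambda>y. \<Sum>j\<in>UNIV. A y $ i $ j *\<^sub>R partial_deriv j h y)"
  by (intro C1_sum C1_scaleR assms(1) C1_partial_deriv assms(2))

lemma continuous_on_divergence_form:
  fixes A :: "real^'n \<Rightarrow> real^'n^'n"
  assumes "\<And>i j. C_k_on (Suc 0) V (\<lambda>y. A y $ i $ j)" "C_k_on (Suc (Suc 0)) V h"
  shows "continuous_on V (divergence_form A h)"
proof -
  have "continuous_on V (\<lambda>y. \<Sum>i\<in>UNIV. partial_deriv i (\<lambda>y. \<Sum>j\<in>UNIV. A y $ i $ j *\<^sub>R partial_deriv j h y) y)"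
    unfolding partial_deriv_def[where h = "\<lambda>y. \<Sum>j\<in>UNIV. A y $ _ $ j *\<^sub>R partial_deriv j h y"]
    by (intro continuous_on_sum C1_continuous_derivative[OF C1_divergence_form_flux] assms)
  then show ?thesis
    unfolding divergence_form_def .
qed

lemma divergence_form_support:
  fixes A :: "real^'n \<Rightarrow> real^'n^'n"
  assumes "closed K" "\<And>y. y \<notin> K \<Longrightarrow> h y = 0" "y \<notin> K"
  shows "partial_deriv j h y = 0" "divergence_form A h y = 0"
proof -
  have zero: "partial_deriv i k y = 0" if "\<And>y. y \<notin> K \<Longrightarrow> k y = 0" "y \<notin> K"
    for i y and k :: "real^'n \<Rightarrow> 'c::real_normed_vector"
  proof -
    have "(k has_derivative (\<lambda>_. 0)) (at y)"
      using has_derivative_const[of 0 "at y"] open_Compl[OF assms(1)]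
      by (rule has_derivative_transform_within_open) (use that in auto)
    then show ?thesis
      unfolding partial_deriv_def by (metis frechet_derivative_at)
  qed
  show "partial_deriv j h y = 0"
    by (rule zero[OF assms(2,3)])
  have "partial_deriv i (\<lambda>y. \<Sum>j\<in>UNIV. A y $ i $ j *\<^sub>R partial_deriv j h y) y = 0" for i
    by (rule zero[OF _ assms(3)]) (simp add: zero[OF assms(2)])
  then show "divergence_form A h y = 0"
    by (simp add: divergence_form_def)
qed

text \<open>The difference of the integrands is the divergence of the field E, that is
  \<open>(A grad b) u - b (A grad u)\<close>: the two terms with a product of gradients cancel
  because A is symmetric. E inherits compact support from \<open>b\<close>, while \<open>u\<close>
  may be any C^2 function on \<open>V\<close>, such as an eigenfunction in a chart.\<close>

lemma Green_second_identity:
  fixes A :: "real^'n \<Rightarrow> real^'n^'n" and b :: "real^'n \<Rightarrow> real" and u :: "real^'n \<Rightarrow> complex"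
  assumes K: "compact K" "K \<subseteq> V"
    and A: "\<And>i j. C_k_on (Suc 0) V (\<lambda>y. A y $ i $ j)" "\<And>y i j. y \<in> V \<Longrightarrow> A y $ i $ j = A y $ j $ i"
    and b: "C_k_on (Suc (Suc 0)) V b" "\<And>y. y \<notin> K \<Longrightarrow> b y = 0"
    and u: "C_k_on (Suc (Suc 0)) V u"
  shows "(\<integral>y. divergence_form A b y *\<^sub>R u y \<partial>lborel) = (\<integral>y. b y *\<^sub>R divergence_form A u y \<partial>lborel)"
proof -
  define q where "q = (\<lambda>i y. \<Sum>j\<in>UNIV. A y $ i $ j *\<^sub>R partial_deriv j b y)"
  define r where "r = (\<lambda>i y. \<Sum>j\<in>UNIV. A y $ i $ j *\<^sub>R partial_deriv j u y)"
  define E where "E = (\<lambda>i y. q i y *\<^sub>R u y - b y *\<^sub>R r i y)"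
  note closed = compact_imp_closed[OF K(1)]
  have C1: "C_k_on (Suc 0) V (q i)" "C_k_on (Suc 0) V (r i)" "C_k_on (Suc 0) V b" "C_k_on (Suc 0) V u" for i
    unfolding q_def r_def by (intro C1_divergence_form_flux C2_imp_C1 A(1) b(1) u)+
  have E: "C_k_on (Suc 0) V (E i)" for i
  proof -
    have "C_k_on (Suc 0) V (\<lambda>y. q i y *\<^sub>R u y + (- 1) *\<^sub>R (b y *\<^sub>R r i y))"
      by (intro C1_add C1_scaleR C1_const C1)
    then show ?thesis by (simp add: E_def)
  qed
  have E0: "E i y = 0" if "y \<notin> K" for i y
    using that by (simp add: E_def q_def b(2) divergence_form_support(1)[OF closed b(2)])
  have "(\<Sum>i\<in>UNIV. partial_deriv i (E i) y) = divergence_form A b y *\<^sub>R u y - b y *\<^sub>R divergence_form A u y" for y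
  proof (cases "y \<in> K")
    case True
    then have y: "y \<in> V" using K(2) by auto
    then have d: "q i differentiable at y" "r i differentiable at y" "b differentiable at y" "u differentiable at y" for i
      using C1 by auto
    have "partial_deriv i (E i) y = (q i y *\<^sub>R partial_deriv i u y + partial_deriv i (q i) y *\<^sub>R u y)
        - (b y *\<^sub>R partial_deriv i (r i) y + partial_deriv i b y *\<^sub>R r i y)" for i
      unfolding E_def using d
      by (simp add: partial_deriv_diff differentiable_scaleR partial_deriv_bilinear[OF bounded_bilinear_scaleR])
    then have "(\<Sum>i\<in>UNIV. partial_deriv i (E i) y)
        = (\<Sum>i\<in>UNIV. partial_deriv i (q i) y) *\<^sub>R u y - b y *\<^sub>R (\<Sum>i\<in>UNIV. partial_deriv i (r i) y)
        + ((\<Sum>i\<in>UNIV. q i y *\<^sub>R partial_deriv i u y) - (\<Sum>i\<in>UNIV. partial_deriv i b y *\<^sub>R r i y))"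
      by (simp only:) (simp add: sum.distrib sum_subtractf scaleR_sum_left scaleR_sum_right algebra_simps)
    moreover have "(\<Sum>i\<in>UNIV. q i y *\<^sub>R partial_deriv i u y)
        = (\<Sum>i\<in>UNIV. \<Sum>j\<in>UNIV. (A y $ j $ i * partial_deriv j b y) *\<^sub>R partial_deriv i u y)"
      by (simp add: q_def scaleR_sum_left A(2)[OF y, of _ "_::'n"])
    moreover have "\<dots> = (\<Sum>i\<in>UNIV. partial_deriv i b y *\<^sub>R r i y)"
      by (subst sum.swap) (simp add: r_def scaleR_sum_right mult.commute)
    ultimately show ?thesis
      by (simp add: divergence_form_def q_def r_def)
  next
    case False
    then show ?thesis
      using divergence_form_support(1)[OF closed E0 False] divergence_form_support(2)[OF closed b(2) False]
      by (simp add: b(2))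
  qed
  then have "(\<integral>y. divergence_form A b y *\<^sub>R u y - b y *\<^sub>R divergence_form A u y \<partial>lborel)
      = (\<integral>y. (\<Sum>i\<in>UNIV. partial_deriv i (E i) y) \<partial>lborel)"
    by simp
  also have "\<dots> = 0"
    using integral_partial_deriv_compact_support[OF K E E0]
    by (subst Bochner_Integration.integral_sum) auto
  finally have "(\<integral>y. divergence_form A b y *\<^sub>R u y - b y *\<^sub>R divergence_form A u y \<partial>lborel) = 0" .
  moreover have "integrable lborel (\<lambda>y. divergence_form A b y *\<^sub>R u y)"
    using divergence_form_support(2)[OF closed b(2)]
    by (intro integrable_compact_support[OF K(1)] continuous_on_subset[OF _ K(2)] continuous_on_scaleR
        continuous_on_divergence_form[OF A(1) b(1)] C1_imp_continuous_on C1) auto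
  moreover have "integrable lborel (\<lambda>y. b y *\<^sub>R divergence_form A u y)"
    using b(2)
    by (intro integrable_compact_support[OF K(1)] continuous_on_subset[OF _ K(2)] continuous_on_scaleR
        continuous_on_divergence_form[OF A(1) u] C1_imp_continuous_on C1) auto
  ultimately show ?thesis
    by simp
qed

subsection \<open>Transfer to a chart\<close>

text \<open>Continuity is asked on \<open>K\<close> alone because functions pulled back from the
  manifold are controlled only on the image of the chart.\<close>

lemma measurable_compact_support:
  fixes f :: "real^'n \<Rightarrow> 'b::real_normed_vector"
  assumes "compact K" "continuous_on K f" "\<And>y. y \<notin> K \<Longrightarrow> f y = 0"
  shows "f \<in> borel_measurable borel"
proof -
  have "(\<lambda>y. indicator K y *\<^sub>R f y) = f"
    using assms(3) by (auto simp: indicator_def)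
  moreover have "(\<lambda>y. indicator K y *\<^sub>R f y) \<in> borel_measurable borel"
    using assms(1,2) by (intro borel_measurable_continuous_on_indicator) (auto intro: borel_compact)
  ultimately show ?thesis by simp
qed

lemma matrix_inv_symmetric:
  fixes M :: "real^'n^'n"
  assumes "transpose M = M" "det M \<noteq> 0"
  shows "matrix_inv M $ i $ j = matrix_inv M $ j $ i"
proof -
  define N where "N = matrix_inv M"
  have N: "M ** N = mat 1" "N ** M = mat 1"
    using assms(2) someI_ex[of "\<lambda>M'. M ** M' = mat 1 \<and> M' ** M = mat 1"]
    by (simp_all add: N_def matrix_inv_def invertible_det_nz[symmetric] invertible_def)
  have "transpose N ** M = mat 1"
    using arg_cong[OF N(1), of transpose] by (simp add: matrix_transpose_mul assms(1) transpose_mat)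
  then have "transpose N = N"
    using N(1) by (metis matrix_mul_assoc matrix_mul_lid matrix_mul_rid)
  then have "transpose N $ j $ i = N $ j $ i"
    by simp
  then show ?thesis
    by (simp add: transpose_def N_def)
qed

definition volume_density :: "(('a, 'n::finite) chart \<Rightarrow> 'a \<Rightarrow> real^'n^'n) \<Rightarrow> ('a, 'n) chart \<Rightarrow> real^'n \<Rightarrow> real"
  where "volume_density g c y = sqrt (det (g c (chart_inv c y)))"

definition laplace_coeff :: "(('a, 'n::finite) chart \<Rightarrow> 'a \<Rightarrow> real^'n^'n) \<Rightarrow> ('a, 'n) chart \<Rightarrow> real^'n \<Rightarrow> real^'n^'n"
  where "laplace_coeff g c y = volume_density g c y *\<^sub>R matrix_inv (g c (chart_inv c y))"

definition extend_by_zero :: "('a, 'n::finite) chart \<Rightarrow> (real^'n \<Rightarrow> 'b::zero) \<Rightarrow> 'a \<Rightarrow> 'b"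
  where "extend_by_zero c H x = (if x \<in> fst c then H (snd c x) else 0)"

lemma laplace_beltrami_eq_divergence_form:
  "laplace_beltrami g c f x = divergence_form (laplace_coeff g c) (f \<circ> chart_inv c) (snd c x) /\<^sub>R volume_density g c (snd c x)"
  by (simp add: laplace_beltrami_def divergence_form_def laplace_coeff_def volume_density_def
      Let_def scaleR_sum_right)

section \<open>Charts and the volume measure of a compact Riemannian manifold\<close>

locale riemannian_manifold =
  fixes X :: "'a topology" and A :: "('a, 'n::finite) chart set"
    and g :: "('a, 'n) chart \<Rightarrow> 'a \<Rightarrow> real^'n^'n" and \<mu> :: "'a measure"
  assumes manifold: "compact_smooth_manifold X A"
    and metric: "riemannian_metric A g"
    and volume: "riemannian_volume X A g \<mu>"
begin

lemma chart:
  assumes "c \<in> A"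
  shows "openin X (fst c)" "open (snd c ` fst c)"
    and "homeomorphic_map (subtopology X (fst c)) (top_of_set (snd c ` fst c)) (snd c)"
  using manifold assms
  by (auto simp: compact_smooth_manifold_def smooth_atlas_def is_chart_def)

lemma chart_subset: "c \<in> A \<Longrightarrow> fst c \<subseteq> topspace X"
  using chart(1) openin_subset by blast

lemma chart_inv_apply:
  assumes "c \<in> A" "x \<in> fst c"
  shows "chart_inv c (snd c x) = x"
proof -
  have "inj_on (snd c) (fst c)"
    using homeomorphic_imp_injective_map[OF chart(3)[OF assms(1)]] chart_subset[OF assms(1)]
    by (simp add: Int_absorb1)
  then show ?thesis
    using assms(2) by (simp add: chart_inv_def)
qed

lemma chart_inv_mem:
  assumes "y \<in> snd c ` fst c"
  shows "chart_inv c y \<in> fst c" "snd c (chart_inv c y) = y"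
  using assms by (auto simp: chart_inv_def inv_into_into f_inv_into_f)

lemma vimage_open:
  assumes "c \<in> A" "open S"
  shows "openin X (snd c -` S \<inter> fst c)"
proof -
  have "continuous_map (subtopology X (fst c)) (top_of_set (snd c ` fst c)) (snd c)"
    using chart(3)[OF assms(1)] by (rule homeomorphic_imp_continuous_map)
  then have "continuous_map (subtopology X (fst c)) euclidean (snd c)"
    by (simp add: continuous_map_in_subtopology)
  then have "openin (subtopology X (fst c)) {x \<in> topspace (subtopology X (fst c)). snd c x \<in> S}"
    using assms(2) by (intro openin_continuous_map_preimage) auto
  moreover have "{x \<in> topspace (subtopology X (fst c)). snd c x \<in> S} = snd c -` S \<inter> fst c"
    using chart_subset[OF assms(1)] by auto
  ultimately show ?thesis
    using openin_trans_full chart(1)[OF assms(1)] by fastforce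
qed

lemma det_pos:
  assumes "c \<in> A" "y \<in> snd c ` fst c"
  shows "0 < det (g c (chart_inv c y))"
  using metric assms chart_inv_mem[OF assms(2)]
  by (intro det_pos_of_positive_definite) (auto simp: riemannian_metric_def)

lemma C1_metric:
  assumes "c \<in> A"
  shows "C_k_on (Suc 0) (snd c ` fst c) (\<lambda>y. g c (chart_inv c y) $ i $ j)"
proof -
  have "C_k_on (Suc 0) (snd c ` fst c) (g c \<circ> chart_inv c)"
    using metric assms unfolding riemannian_metric_def smooth_on_def by blast
  from C1_component[OF this] show ?thesis
    by (simp add: o_def del: C_k_on.simps)
qed

lemma volume_density_pos: "c \<in> A \<Longrightarrow> y \<in> snd c ` fst c \<Longrightarrow> 0 < volume_density g c y"
  using det_pos by (simp add: volume_density_def)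

lemma C1_volume_density:
  assumes "c \<in> A"
  shows "C_k_on (Suc 0) (snd c ` fst c) (volume_density g c)"
proof -
  have "C_k_on (Suc 0) (snd c ` fst c) (\<lambda>y. sqrt (det (g c (chart_inv c y))))"
  proof (rule C1_compose_real[where f = "\<lambda>y. det (g c (chart_inv c y))" and h = sqrt and S = "{0<..}"
        and h' = "\<lambda>s. inverse (sqrt s) / 2"])
    show "C_k_on (Suc 0) (snd c ` fst c) (\<lambda>y. det (g c (chart_inv c y)))"
      by (rule C1_det[OF C1_metric[OF assms]])
    show "continuous_on {0<..} (\<lambda>s::real. inverse (sqrt s) / 2)"
      by (intro continuous_intros) auto
  qed (use det_pos[OF assms] in \<open>auto intro: DERIV_real_sqrt\<close>)
  then show ?thesis
    by (simp add: volume_density_def[abs_def] del: C_k_on.simps)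
qed

lemma C1_laplace_coeff:
  assumes "c \<in> A"
  shows "C_k_on (Suc 0) (snd c ` fst c) (\<lambda>y. laplace_coeff g c y $ i $ j)"
proof -
  have "C_k_on (Suc 0) (snd c ` fst c) (\<lambda>y. volume_density g c y * matrix_inv (g c (chart_inv c y)) $ i $ j)"
    using det_pos[OF assms]
    by (intro C1_mult C1_volume_density C1_matrix_inv_component C1_metric chart(2) assms) force
  then show ?thesis
    by (simp add: laplace_coeff_def del: C_k_on.simps)
qed

lemma laplace_coeff_symmetric:
  assumes "c \<in> A" "y \<in> snd c ` fst c"
  shows "laplace_coeff g c y $ i $ j = laplace_coeff g c y $ j $ i"
proof -
  have "transpose (g c (chart_inv c y)) = g c (chart_inv c y)"
    using metric assms chart_inv_mem[OF assms(2)] by (auto simp: riemannian_metric_def)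
  then have "matrix_inv (g c (chart_inv c y)) $ i $ j = matrix_inv (g c (chart_inv c y)) $ j $ i"
    by (rule matrix_inv_symmetric) (use det_pos[OF assms] in auto)
  then show ?thesis
    by (simp add: laplace_coeff_def)
qed

lemma space_volume: "space \<mu> = topspace X"
  using volume by (simp add: riemannian_volume_def)

lemma open_sets: "openin X S \<Longrightarrow> S \<in> sets \<mu>"
  using volume by (auto simp: riemannian_volume_def)

lemma chart_measurable:
  assumes "c \<in> A"
  shows "snd c \<in> borel_measurable (restrict_space \<mu> (fst c))"
proof (rule borel_measurableI)
  fix S :: "(real^'n) set" assume "open S"
  have "snd c -` S \<inter> fst c \<in> sets \<mu>"
    by (intro open_sets vimage_open assms \<open>open S\<close>)
  then show "snd c -` S \<inter> space (restrict_space \<mu> (fst c)) \<in> sets (restrict_space \<mu> (fst c))"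
    using chart_subset[OF assms] open_sets[OF chart(1)[OF assms]]
    by (auto simp: space_restrict_space sets_restrict_space_iff space_volume Int_absorb2)
qed

lemma measurable_volume_density:
  assumes "c \<in> A"
  shows "(\<lambda>y. indicator (snd c ` fst c) y * volume_density g c y) \<in> borel_measurable borel"
  using borel_measurable_continuous_on_indicator[OF _ C1_imp_continuous_on[OF C1_volume_density[OF assms]]]
    chart(2)[OF assms] by simp

text \<open>The volume is specified by its values on the Borel sets inside a chart, which amounts to
  this identity of measures; integrals over a chart then follow from the transformation rules for
  \<open>distr\<close> and \<open>density\<close>. The indicator removes the values of
  \<open>volume_density\<close> off the image of the chart, where \<open>chart_inv\<close> is
  arbitrary.\<close>

lemma distr_chart:
  assumes c: "c \<in> A"
  shows "distr (restrict_space \<mu> (fst c)) borel (snd c)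
       = density lborel (\<lambda>y. ennreal (indicator (snd c ` fst c) y * volume_density g c y))"
proof (rule measure_eqI)
  fix B assume "B \<in> sets (distr (restrict_space \<mu> (fst c)) borel (snd c))"
  then have B: "B \<in> sets borel" by simp
  have sp: "space (restrict_space \<mu> (fst c)) = fst c"
    using chart_subset[OF c] by (auto simp: space_restrict_space space_volume)
  have "snd c -` B \<inter> fst c \<in> sets (restrict_space \<mu> (fst c))"
    using measurable_sets[OF chart_measurable[OF c] B] sp by simp
  then have m: "snd c -` B \<inter> fst c \<in> sets \<mu>"
    using open_sets[OF chart(1)[OF c]] by (subst (asm) sets_restrict_space_iff) auto
  have "emeasure (distr (restrict_space \<mu> (fst c)) borel (snd c)) B = emeasure \<mu> (snd c -` B \<inter> fst c)"
    using open_sets[OF chart(1)[OF c]] chart_subset[OF c]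
    by (simp add: emeasure_distr chart_measurable[OF c] B sp emeasure_restrict_space)
  also have "\<dots> = (\<integral>\<^sup>+y\<in>snd c ` (snd c -` B \<inter> fst c). ennreal (volume_density g c y) \<partial>lborel)"
    using volume c m by (simp add: riemannian_volume_def volume_density_def)
  also have "\<dots> = (\<integral>\<^sup>+y. ennreal (indicator (snd c ` fst c) y * volume_density g c y) * indicator B y \<partial>lborel)"
  proof (rule nn_integral_cong)
    fix y
    have "snd c ` (snd c -` B \<inter> fst c) = B \<inter> snd c ` fst c" by auto
    then show "ennreal (volume_density g c y) * indicator (snd c ` (snd c -` B \<inter> fst c)) y
        = ennreal (indicator (snd c ` fst c) y * volume_density g c y) * indicator B y"
      by (simp add: indicator_def)
  qed
  also have "\<dots> = emeasure (density lborel (\<lambda>y. ennreal (indicator (snd c ` fst c) y * volume_density g c y))) B"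
    using B measurable_volume_density[OF c] by (subst emeasure_density) auto
  finally show "emeasure (distr (restrict_space \<mu> (fst c)) borel (snd c)) B
      = emeasure (density lborel (\<lambda>y. ennreal (indicator (snd c ` fst c) y * volume_density g c y))) B" .
qed simp

lemma extend_by_zero_integral:
  fixes H :: "real^'n \<Rightarrow> 'b::{banach, second_countable_topology}"
  assumes c: "c \<in> A" and H: "H \<in> borel_measurable borel" and "\<And>y. y \<notin> snd c ` fst c \<Longrightarrow> H y = 0"
  shows "extend_by_zero c H \<in> borel_measurable \<mu>"
    and "integrable \<mu> (extend_by_zero c H) \<longleftrightarrow> integrable lborel (\<lambda>y. volume_density g c y *\<^sub>R H y)"
    and "(\<integral>x. extend_by_zero c H x \<partial>\<mu>) = (\<integral>y. volume_density g c y *\<^sub>R H y \<partial>lborel)"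
proof -
  let ?U = "fst c" and ?w = "\<lambda>y. indicator (snd c ` fst c) y * volume_density g c y"
  have U: "?U \<inter> space \<mu> \<in> sets \<mu>"
    using open_sets[OF chart(1)[OF c]] by auto
  have ext: "extend_by_zero c H = (\<lambda>x. indicator ?U x *\<^sub>R H (snd c x))"
    by (auto simp: extend_by_zero_def indicator_def)
  have m: "(\<lambda>x. H (snd c x)) \<in> borel_measurable (restrict_space \<mu> ?U)"
    using measurable_compose[OF chart_measurable[OF c] H] .
  show "extend_by_zero c H \<in> borel_measurable \<mu>"
    using m unfolding ext borel_measurable_restrict_space_iff[OF U] .
  have w: "AE y in lborel. 0 \<le> ?w y"
    using volume_density_pos[OF c] by (intro AE_I2) (auto simp: indicator_def intro: less_imp_le)
  have wH: "(\<lambda>y. ?w y *\<^sub>R H y) = (\<lambda>y. volume_density g c y *\<^sub>R H y)"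
  proof
    show "?w y *\<^sub>R H y = volume_density g c y *\<^sub>R H y" for y
      using assms(3)[of y] by (cases "y \<in> snd c ` fst c") auto
  qed
  note wm = measurable_volume_density[OF c]
  have "integrable \<mu> (extend_by_zero c H) \<longleftrightarrow> integrable (restrict_space \<mu> ?U) (\<lambda>x. H (snd c x))"
    unfolding ext by (rule integrable_restrict_space[OF U, symmetric])
  also have "\<dots> \<longleftrightarrow> integrable (distr (restrict_space \<mu> ?U) borel (snd c)) H"
    by (rule integrable_distr_eq[OF chart_measurable[OF c] H, symmetric])
  also have "\<dots> \<longleftrightarrow> integrable lborel (\<lambda>y. ?w y *\<^sub>R H y)"
    unfolding distr_chart[OF c] by (rule integrable_density) (use H wm w in auto)
  finally show "integrable \<mu> (extend_by_zero c H) \<longleftrightarrow> integrable lborel (\<lambda>y. volume_density g c y *\<^sub>R H y)"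
    unfolding wH .
  have "(\<integral>x. extend_by_zero c H x \<partial>\<mu>) = (\<integral>x. H (snd c x) \<partial>restrict_space \<mu> ?U)"
    unfolding ext by (rule integral_restrict_space[OF U, symmetric])
  also have "\<dots> = (\<integral>y. H y \<partial>distr (restrict_space \<mu> ?U) borel (snd c))"
    by (rule integral_distr[OF chart_measurable[OF c] H, symmetric])
  also have "\<dots> = (\<integral>y. ?w y *\<^sub>R H y \<partial>lborel)"
    unfolding distr_chart[OF c] by (rule integral_density) (use H wm w in auto)
  finally show "(\<integral>x. extend_by_zero c H x \<partial>\<mu>) = (\<integral>y. volume_density g c y *\<^sub>R H y \<partial>lborel)"
    unfolding wH .
qed

text \<open>The density is continuous, hence bounded on a closed ball inside the image of a chart,
  so every point has an open neighbourhood of finite volume; compactness leaves finitely many of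
  them.\<close>

lemma finite_volume: "finite_measure \<mu>"
proof
  have local: "\<exists>W. openin X W \<and> x \<in> W \<and> emeasure \<mu> W < \<infinity>" if x: "x \<in> topspace X" for x
  proof -
    have "(\<Union>c\<in>A. fst c) = topspace X"
      using manifold by (simp add: compact_smooth_manifold_def smooth_atlas_def)
    with x obtain c where c: "c \<in> A" "x \<in> fst c"
      by blast
    let ?V = "snd c ` fst c"
    obtain r where r: "r > 0" "cball (snd c x) r \<subseteq> ?V"
      using chart(2)[OF c(1)] c(2) open_contains_cball by blast
    let ?B = "ball (snd c x) r"
    have "bounded (volume_density g c ` cball (snd c x) r)"
      by (intro compact_imp_bounded compact_continuous_image compact_cball
          continuous_on_subset[OF C1_imp_continuous_on[OF C1_volume_density[OF c(1)]] r(2)])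
    then obtain B where B': "\<forall>z\<in>volume_density g c ` cball (snd c x) r. norm z \<le> B"
      unfolding bounded_iff by blast
    have B: "volume_density g c y \<le> B" if "y \<in> ?B" for y
    proof -
      have "norm (volume_density g c y) \<le> B"
        using that ball_subset_cball by (intro B'[rule_format] imageI) blast
      then show ?thesis by simp
    qed
    define W where "W = snd c -` ?B \<inter> fst c"
    have W: "openin X W" "W \<in> sets \<mu>"
      unfolding W_def using vimage_open[OF c(1)] open_sets by auto
    have sub: "snd c ` W = ?B"
    proof -
      have "snd c ` W = ?B \<inter> ?V" by (auto simp: W_def)
      moreover have "?B \<subseteq> ?V" using r(2) ball_subset_cball by (rule subset_trans[rotated])
      ultimately show ?thesis by (simp add: Int_absorb2)
    qed
    have "emeasure \<mu> W = (\<integral>\<^sup>+y\<in>snd c ` W. ennreal (volume_density g c y) \<partial>lborel)"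
      using volume c W(2) by (auto simp: riemannian_volume_def volume_density_def W_def)
    also have "\<dots> \<le> (\<integral>\<^sup>+y. ennreal B * indicator ?B y \<partial>lborel)"
      unfolding sub using B by (intro nn_integral_mono) (auto simp: indicator_def intro!: ennreal_leI)
    also have "\<dots> = ennreal B * emeasure lborel ?B"
      by (rule nn_integral_cmult_indicator) simp
    also have "\<dots> < \<infinity>"
      using emeasure_bounded_finite[OF bounded_ball, of "snd c x" r] by (simp add: ennreal_mult_less_top)
    finally have "emeasure \<mu> W < \<infinity>" .
    moreover have "x \<in> W"
      using c r by (auto simp: W_def)
    ultimately show ?thesis using W(1) by blast
  qed
  define \<W> where "\<W> = {W. openin X W \<and> emeasure \<mu> W < \<infinity>}"
  have "compactin X (topspace X)"
    using manifold by (simp add: compact_smooth_manifold_def compact_space_def)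
  moreover have "topspace X \<subseteq> \<Union>\<W>"
    using local by (auto simp: \<W>_def)
  ultimately obtain F where F: "finite F" "F \<subseteq> \<W>" "topspace X \<subseteq> \<Union>F"
    using compactinD[of X "topspace X" \<W>] by (auto simp: \<W>_def)
  have Fs: "W \<in> sets \<mu>" if "W \<in> F" for W
    using F(2) that open_sets by (auto simp: \<W>_def)
  have "emeasure \<mu> (space \<mu>) \<le> emeasure \<mu> (\<Union>W\<in>F. W)"
    using F Fs by (intro emeasure_mono) (auto simp: space_volume)
  also have "\<dots> \<le> (\<Sum>W\<in>F. emeasure \<mu> W)"
    using F(1) Fs by (intro emeasure_subadditive_finite) auto
  also have "\<dots> < \<infinity>"
    using F(1,2) by (auto simp: \<W>_def less_top)
  finally show "emeasure \<mu> (space \<mu>) \<noteq> \<infinity>" by simp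
qed

text \<open>Here \<open>b\<close> is supported in a single chart; this is the only case in which symmetry of the Laplacian
  is needed, and it avoids partitions of unity.\<close>

lemma laplacian_eigenfunction_inner:
  fixes b :: "real^'n \<Rightarrow> real"
  assumes c: "c \<in> A" and K: "compact K" "K \<subseteq> snd c ` fst c"
    and b: "C_k_on (Suc (Suc 0)) (snd c ` fst c) b" "\<And>y. y \<notin> K \<Longrightarrow> b y = 0"
    and u: "smooth_fun A u" "\<And>x. x \<in> fst c \<Longrightarrow> - laplace_beltrami g c u x = of_real (l\<^sup>2) * u x"
  shows "L2_inner \<mu> (extend_by_zero c (\<lambda>y. complex_of_real (divergence_form (laplace_coeff g c) b y / volume_density g c y))) u
      = - of_real (l\<^sup>2) * L2_inner \<mu> (extend_by_zero c (\<lambda>y. complex_of_real (b y))) u"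
proof -
  let ?V = "snd c ` fst c" and ?w = "volume_density g c" and ?D = "divergence_form (laplace_coeff g c)"
  define v where "v = u \<circ> chart_inv c"
  have v: "C_k_on (Suc (Suc 0)) ?V v"
    using u(1) c unfolding smooth_fun_def smooth_on_def v_def by blast
  have eig: "?D v y = - (of_real (?w y * l\<^sup>2) * v y)" if "y \<in> ?V" for y
  proof -
    note y = chart_inv_mem[OF that]
    have "- (?D v y /\<^sub>R ?w y) = of_real (l\<^sup>2) * v y"
      using u(2)[OF y(1)] y(2) by (simp add: laplace_beltrami_eq_divergence_form v_def)
    then have "?w y *\<^sub>R (?D v y /\<^sub>R ?w y) = - (?w y *\<^sub>R (of_real (l\<^sup>2) * v y))"
      by (metis minus_minus scaleR_minus_right)
    moreover have "?w y *\<^sub>R (?D v y /\<^sub>R ?w y) = ?D v y"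
      using volume_density_pos[OF c that] by (simp del: scaleR_conv_of_real)
    ultimately have "?D v y = - (?w y *\<^sub>R (of_real (l\<^sup>2) * v y))"
      by simp
    then show ?thesis
      by (simp add: scaleR_conv_of_real mult.assoc)
  qed
  have D0: "?D b y = 0" if "y \<notin> K" for y
    by (rule divergence_form_support(2)[OF compact_imp_closed[OF K(1)] b(2) that])
  \<comment> \<open>\<open>L2_inner\<close> conjugates u, whereas Green's identity is linear in u;
    for real h the conjugation can be moved outside the integral.\<close>
  have inner: "L2_inner \<mu> (extend_by_zero c (\<lambda>y. complex_of_real (h y))) u = cnj (\<integral>y. (?w y * h y) *\<^sub>R v y \<partial>lborel)"
    if h: "continuous_on K h" "\<And>y. y \<notin> K \<Longrightarrow> h y = 0" for h :: "real^'n \<Rightarrow> real"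
  proof -
    have m: "(\<lambda>y. h y *\<^sub>R v y) \<in> borel_measurable borel"
      using h by (intro measurable_compact_support[OF K(1)] continuous_on_scaleR
          continuous_on_subset[OF C1_imp_continuous_on[OF C2_imp_C1[OF v]] K(2)]) auto
    have "L2_inner \<mu> (extend_by_zero c (\<lambda>y. complex_of_real (h y))) u
        = (\<integral>x. cnj (extend_by_zero c (\<lambda>y. h y *\<^sub>R v y) x) \<partial>\<mu>)"
      unfolding L2_inner_def
      by (intro Bochner_Integration.integral_cong refl)
        (simp add: extend_by_zero_def v_def chart_inv_apply[OF c] scaleR_conv_of_real)
    also have "\<dots> = cnj (\<integral>x. extend_by_zero c (\<lambda>y. h y *\<^sub>R v y) x \<partial>\<mu>)"
      by simp
    also have "(\<integral>x. extend_by_zero c (\<lambda>y. h y *\<^sub>R v y) x \<partial>\<mu>) = (\<integral>y. ?w y *\<^sub>R (h y *\<^sub>R v y) \<partial>lborel)"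
      using K(2) h(2) by (intro extend_by_zero_integral(3)[OF c m]) auto
    finally show ?thesis by simp
  qed
  have w0: "?w y \<noteq> 0" if "y \<in> K" for y
    using volume_density_pos[OF c] that K(2) by force
  have contw: "continuous_on K ?w"
    by (rule continuous_on_subset[OF C1_imp_continuous_on[OF C1_volume_density[OF c]] K(2)])
  \<comment> \<open>The volume density cancels the outer factor of the Laplacian, so that Green's
    identity for Lebesgue measure applies.\<close>
  have "(\<integral>y. (?w y * (?D b y / ?w y)) *\<^sub>R v y \<partial>lborel) = (\<integral>y. ?D b y *\<^sub>R v y \<partial>lborel)"
  proof (intro Bochner_Integration.integral_cong refl)
    fix y show "(?w y * (?D b y / ?w y)) *\<^sub>R v y = ?D b y *\<^sub>R v y"
      using w0[of y] D0[of y] by (cases "y \<in> K") auto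
  qed
  also have "\<dots> = (\<integral>y. b y *\<^sub>R ?D v y \<partial>lborel)"
    by (rule Green_second_identity[OF K C1_laplace_coeff[OF c] laplace_coeff_symmetric[OF c] b v])
  also have "\<dots> = (\<integral>y. (- of_real (l\<^sup>2)) * ((?w y * b y) *\<^sub>R v y) \<partial>lborel)"
  proof (intro Bochner_Integration.integral_cong refl)
    fix y show "b y *\<^sub>R ?D v y = (- of_real (l\<^sup>2)) * ((?w y * b y) *\<^sub>R v y)"
      using eig[of y] b(2)[of y] K(2) by (cases "y \<in> K") (auto simp: scaleR_conv_of_real)
  qed
  also have "\<dots> = (- of_real (l\<^sup>2)) * (\<integral>y. (?w y * b y) *\<^sub>R v y \<partial>lborel)"
    by (rule integral_mult_right_zero)
  finally have eq: "(\<integral>y. (?w y * (?D b y / ?w y)) *\<^sub>R v y \<partial>lborel)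
      = (- of_real (l\<^sup>2)) * (\<integral>y. (?w y * b y) *\<^sub>R v y \<partial>lborel)" .
  have "continuous_on K (\<lambda>y. ?D b y / ?w y)"
    using w0 by (intro continuous_on_divide contw
        continuous_on_subset[OF continuous_on_divergence_form[OF C1_laplace_coeff[OF c] b(1)] K(2)]) auto
  moreover have "continuous_on K b"
    by (rule continuous_on_subset[OF C1_imp_continuous_on[OF C2_imp_C1[OF b(1)]] K(2)])
  ultimately show ?thesis
    using D0 b(2) by (subst (1 2) inner) (simp_all only: eq, simp_all)
qed

end

subsection \<open>Lower Weyl bound\<close>

lemma DERIV_pos_part_power:
  fixes t :: real
  assumes "k > 0"
  shows "((\<lambda>t. (max 0 t) ^ Suc k) has_real_derivative (real (Suc k) * (max 0 t) ^ k)) (at t)"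
proof -
  consider "t > 0" | "t < 0" | "t = 0" by linarith
  then show ?thesis
  proof cases
    case 1
    have "((\<lambda>t. t ^ Suc k) has_real_derivative (real (Suc k) * (max 0 t) ^ k)) (at t)"
      using 1 DERIV_pow[of "Suc k" t UNIV] by simp
    then show ?thesis
      by (rule has_field_derivative_transform_within_open[where S = "{0<..}"]) (use 1 in auto)
  next
    case 2
    have "real (Suc k) * (max 0 t) ^ k = 0"
      using 2 assms by (simp add: max_def)
    then have "((\<lambda>t. 0) has_real_derivative (real (Suc k) * (max 0 t) ^ k)) (at t)"
      by (simp only: DERIV_const)
    then show ?thesis
      by (rule has_field_derivative_transform_within_open[where S = "{..<0}"]) (use 2 in auto)
  next
    case 3
    \<comment> \<open>At the kink the difference quotient is at most \<open>|h| ^ k\<close>, which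
      tends to 0 because k is positive.\<close>
    have "((\<lambda>h::real. (max 0 h) ^ Suc k / h) \<longlongrightarrow> 0) (at 0)"
    proof (rule Lim_null_comparison)
      show "\<forall>\<^sub>F h in at 0. norm ((max 0 h) ^ Suc k / h) \<le> \<bar>h\<bar> ^ k"
        by (intro always_eventually) (auto simp: max_def power_abs)
      have "((\<lambda>h::real. \<bar>h\<bar> ^ k) \<longlongrightarrow> \<bar>0\<bar> ^ k) (at 0)"
        by (intro tendsto_intros)
      then show "((\<lambda>h::real. \<bar>h\<bar> ^ k) \<longlongrightarrow> 0) (at 0)"
        by (simp only: abs_zero zero_power[OF assms])
    qed
    moreover have "real (Suc k) * (max 0 (0::real)) ^ k = 0"
      using assms by (simp add: zero_power)
    ultimately show ?thesis
      unfolding 3 DERIV_def by (simp only:) simp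
  qed
qed

text \<open>With the squared norm the expression inside the maximum is a polynomial in y, so
  smoothness can fail only on the sphere of radius s and not at the centre.\<close>

definition bump_base :: "real^'n \<Rightarrow> real \<Rightarrow> real^'n \<Rightarrow> real"
  where "bump_base c s y = max 0 (1 - (norm (y - c))\<^sup>2 / s\<^sup>2)"

text \<open>The cube makes the bump twice continuously differentiable, which is all the argument needs.\<close>

definition bump :: "real^'n \<Rightarrow> real \<Rightarrow> real^'n \<Rightarrow> real"
  where "bump c s y = bump_base c s y ^ 3"

lemma bump_base_power_has_derivative:
  assumes "k > 0"
  shows "((\<lambda>y. bump_base c s y ^ Suc k) has_derivative
    (\<lambda>v. real (Suc k) * bump_base c s y ^ k * (- 2 * ((y - c) \<bullet> v) / s\<^sup>2))) (at y)"
proof -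
  have "((\<lambda>y. 1 - (y - c) \<bullet> (y - c) / s\<^sup>2) has_derivative (\<lambda>v. - 2 * ((y - c) \<bullet> v) / s\<^sup>2)) (at y)"
  proof -
    have "((\<lambda>y. 1 - (y - c) \<bullet> (y - c) * k) has_derivative (\<lambda>v. - 2 * ((y - c) \<bullet> v) * k)) (at y)" for k
      by (auto intro!: derivative_eq_intros simp: inner_commute)
    then show ?thesis
      unfolding divide_inverse .
  qed
  from has_derivative_compose[OF this DERIV_pos_part_power[OF assms, unfolded has_field_derivative_def]]
  show ?thesis
    by (simp add: bump_base_def power2_norm_eq_inner)
qed

lemma frechet_derivative_bump:
  "frechet_derivative (bump c s) (at y) = (\<lambda>v. - 6 / s\<^sup>2 * (bump_base c s y ^ 2 * ((y - c) \<bullet> v)))"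
  "bump c s differentiable (at y)"
proof -
  have "(bump c s has_derivative (\<lambda>v. - 6 / s\<^sup>2 * (bump_base c s y ^ 2 * ((y - c) \<bullet> v)))) (at y)"
  proof -
    have eq: "real (Suc 2) * m * (- 2 * x / s\<^sup>2) = - 6 / s\<^sup>2 * (m * x)" for m x
      by simp
    show ?thesis
      using bump_base_power_has_derivative[of 2 c s y] unfolding eq by (simp add: bump_def[abs_def])
  qed
  then show "frechet_derivative (bump c s) (at y) = (\<lambda>v. - 6 / s\<^sup>2 * (bump_base c s y ^ 2 * ((y - c) \<bullet> v)))"
    "bump c s differentiable (at y)"
    by (auto simp: frechet_derivative_at[symmetric] differentiable_def)
qed

lemma bump_second_derivative:
  "((\<lambda>y. - 6 / s\<^sup>2 * (bump_base c s y ^ 2 * ((y - c) \<bullet> v))) has_derivative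
    (\<lambda>w. - 6 / s\<^sup>2 * (bump_base c s y ^ 2 * (w \<bullet> v)
        + 2 * bump_base c s y * (- 2 * ((y - c) \<bullet> w) / s\<^sup>2) * ((y - c) \<bullet> v)))) (at y)"
proof -
  have "((\<lambda>y. bump_base c s y ^ 2) has_derivative (\<lambda>w. 2 * bump_base c s y * (- 2 * ((y - c) \<bullet> w) / s\<^sup>2))) (at y)"
    using bump_base_power_has_derivative[of 1 c s y] by (simp add: numeral_2_eq_2)
  moreover have "((\<lambda>y. (y - c) \<bullet> v) has_derivative (\<lambda>w. w \<bullet> v)) (at y)"
    by (auto intro!: derivative_eq_intros)
  ultimately show ?thesis
    by (intro has_derivative_mult_right has_derivative_mult)
qed

lemma continuous_on_bump_base: "continuous_on S (bump_base c s)"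
  unfolding bump_base_def divide_inverse by (intro continuous_intros)

lemma C2_bump: "C_k_on (Suc (Suc 0)) V (bump c s)"
proof -
  have "C_k_on (Suc 0) V (\<lambda>y. frechet_derivative (bump c s) (at y) v)" for v
    unfolding frechet_derivative_bump(1)
  proof (rule C1I)
    show "((\<lambda>y. - 6 / s\<^sup>2 * (bump_base c s y ^ 2 * ((y - c) \<bullet> v))) has_derivative
      (\<lambda>w. - 6 / s\<^sup>2 * (bump_base c s y ^ 2 * (w \<bullet> v)
        + 2 * bump_base c s y * (- 2 * ((y - c) \<bullet> w) / s\<^sup>2) * ((y - c) \<bullet> v)))) (at y)" for y
      by (rule bump_second_derivative)
  qed (unfold divide_inverse, intro continuous_intros continuous_on_bump_base)
  then show ?thesis
    by (simp add: frechet_derivative_bump(2))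
qed

lemma bump_base_bounds:
  assumes "s > 0"
  shows "0 \<le> bump_base c s y" "bump_base c s y \<le> 1" "s \<le> norm (y - c) \<Longrightarrow> bump_base c s y = 0"
proof -
  show "0 \<le> bump_base c s y" "bump_base c s y \<le> 1"
    by (auto simp: bump_base_def)
  show "bump_base c s y = 0" if "s \<le> norm (y - c)"
  proof -
    have "s\<^sup>2 \<le> (norm (y - c))\<^sup>2"
      using that assms by (intro power_mono) auto
    then show ?thesis
      using assms by (simp add: bump_base_def)
  qed
qed

lemma bump_support: "s > 0 \<Longrightarrow> y \<notin> ball c s \<Longrightarrow> bump c s y = 0"
  using bump_base_bounds(3)[of s y c] by (simp add: bump_def dist_norm norm_minus_commute)

text \<open>On the half ball the base is at least 1 - 1/4, and 27/64 is the cube of 3/4. This makes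
  the squared norm of a bump comparable to the volume of its support.\<close>

lemma bump_ge:
  assumes "s > 0" "y \<in> ball c (s / 2)"
  shows "27 / 64 \<le> bump c s y"
proof -
  have "norm (y - c) \<le> s / 2"
    using assms(2) by (simp add: dist_norm norm_minus_commute)
  then have "(norm (y - c))\<^sup>2 \<le> (s / 2)\<^sup>2"
    by (intro power_mono) auto
  then have "(norm (y - c))\<^sup>2 / s\<^sup>2 \<le> 1 / 4"
    using assms(1) by (simp add: field_simps)
  then have "3 / 4 \<le> 1 - (norm (y - c))\<^sup>2 / s\<^sup>2"
    by linarith
  also have "\<dots> \<le> bump_base c s y"
    by (simp add: bump_base_def)
  finally have "(3 / 4) ^ 3 \<le> bump_base c s y ^ 3"
    by (intro power_mono) auto
  then show ?thesis
    by (simp add: bump_def power3_eq_cube)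
qed

lemma partial_deriv_bump:
  fixes c :: "real^'n"
  shows "partial_deriv j (bump c s) y = - 6 / s\<^sup>2 * (bump_base c s y ^ 2 * (y - c) $ j)"
    and "partial_deriv i (partial_deriv j (bump c s)) y = - 6 / s\<^sup>2 * (bump_base c s y ^ 2 * (if i = j then 1 else 0)
        + 2 * bump_base c s y * (- 2 * (y - c) $ i / s\<^sup>2) * (y - c) $ j)"
proof -
  have 1: "partial_deriv j (bump c s) = (\<lambda>y. - 6 / s\<^sup>2 * (bump_base c s y ^ 2 * ((y - c) \<bullet> axis j 1)))"
    by (simp add: partial_deriv_def frechet_derivative_bump(1) fun_eq_iff)
  then show "partial_deriv j (bump c s) y = - 6 / s\<^sup>2 * (bump_base c s y ^ 2 * (y - c) $ j)"
    by (simp add: inner_axis)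
  have inner: "(axis i 1 :: real^'n) \<bullet> axis j 1 = (if i = j then 1 else 0)" "x \<bullet> axis k 1 = x $ k"
    for x :: "real^'n" and k
    by (simp_all only: inner_axis) (simp_all add: axis_def)
  have "partial_deriv i (partial_deriv j (bump c s)) y = - 6 / s\<^sup>2 * (bump_base c s y ^ 2 * ((axis i 1 :: real^'n) \<bullet> axis j 1)
        + 2 * bump_base c s y * (- 2 * ((y - c) \<bullet> axis i 1) / s\<^sup>2) * ((y - c) \<bullet> axis j 1))"
    unfolding 1 unfolding partial_deriv_def frechet_derivative_at[OF bump_second_derivative, symmetric] ..
  then show "partial_deriv i (partial_deriv j (bump c s)) y = - 6 / s\<^sup>2 * (bump_base c s y ^ 2 * (if i = j then 1 else 0)
        + 2 * bump_base c s y * (- 2 * (y - c) $ i / s\<^sup>2) * (y - c) $ j)"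
    unfolding inner(1) unfolding inner(2) .
qed

text \<open>On the support the coordinates of y - c are at most s, so second derivatives are bounded
  by (6 / s^2)(1 + 4). First derivatives are only of order 1/s; since s is at most 1 they obey the
  same bound, which absorbs the lower-order terms of the operator.\<close>

lemma partial_deriv_bump_bound:
  fixes c :: "real^'n"
  assumes "0 < s" "s \<le> 1"
  shows "\<bar>partial_deriv j (bump c s) y\<bar> \<le> 30 / s\<^sup>2" (is ?A)
    and "\<bar>partial_deriv i (partial_deriv j (bump c s)) y\<bar> \<le> 30 / s\<^sup>2" (is ?B)
proof -
  let ?m = "bump_base c s y"
  have "?A \<and> ?B"
  proof (cases "s \<le> norm (y - c)")
    case True
    then show ?thesis
      using bump_base_bounds(3)[OF assms(1) True] unfolding partial_deriv_bump by simp
  next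
    case False
    have le: "\<bar>(y - c) $ k\<bar> \<le> s" for k
      using component_le_norm_cart[of "y - c" k] False by linarith
    note m = bump_base_bounds(1,2)[OF assms(1), of c y]
    have m2: "?m\<^sup>2 \<le> 1"
      using m by (simp add: power_le_one)
    have "\<bar>?m\<^sup>2 * (y - c) $ j\<bar> \<le> 1 * s"
      unfolding abs_mult using le m2 by (intro mult_mono) auto
    then have "6 / s\<^sup>2 * \<bar>?m\<^sup>2 * (y - c) $ j\<bar> \<le> 6 / s\<^sup>2 * 5"
      using assms by (intro mult_left_mono) auto
    then have A: ?A
      unfolding partial_deriv_bump abs_mult[of "- 6 / s\<^sup>2"] using assms(1) by simp
    have "\<bar>(y - c) $ i * (y - c) $ j\<bar> \<le> s * s"
      unfolding abs_mult using le assms by (intro mult_mono) auto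
    then have "\<bar>(y - c) $ i * (y - c) $ j / s\<^sup>2\<bar> \<le> 1"
      using assms(1) by (simp add: power2_eq_square)
    then have "?m * \<bar>(y - c) $ i * (y - c) $ j / s\<^sup>2\<bar> \<le> 1 * 1"
      using m by (intro mult_mono) auto
    then have "\<bar>4 * (?m * ((y - c) $ i * (y - c) $ j / s\<^sup>2))\<bar> \<le> 4"
      using m by (simp add: abs_mult)
    moreover have "\<bar>?m\<^sup>2 * (if i = j then 1 else 0)\<bar> \<le> 1"
      using m2 by simp
    moreover have "2 * ?m * (- 2 * (y - c) $ i / s\<^sup>2) * (y - c) $ j = - (4 * (?m * ((y - c) $ i * (y - c) $ j / s\<^sup>2)))"
    proof -
      have "2 * x * (- 2 * y / q) * z = - (4 * (x * (y * z / q)))" for x y z q :: real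
        by simp
      then show ?thesis .
    qed
    ultimately have "\<bar>?m\<^sup>2 * (if i = j then 1 else 0) + 2 * ?m * (- 2 * (y - c) $ i / s\<^sup>2) * (y - c) $ j\<bar> \<le> 5"
      by linarith
    then have "6 / s\<^sup>2 * \<bar>?m\<^sup>2 * (if i = j then 1 else 0) + 2 * ?m * (- 2 * (y - c) $ i / s\<^sup>2) * (y - c) $ j\<bar> \<le> 6 / s\<^sup>2 * 5"
      using assms by (intro mult_left_mono) auto
    then have ?B
      unfolding partial_deriv_bump abs_mult[of "- 6 / s\<^sup>2"] using assms(1) by simp
    with A show ?thesis ..
  qed
  then show ?A ?B by auto
qed

section \<open>Divergence-form operators applied to bumps\<close>

lemma partial_deriv_sum:
  assumes "\<And>j. j \<in> F \<Longrightarrow> f j differentiable (at y)"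
  shows "partial_deriv i (\<lambda>y. \<Sum>j\<in>F. f j y) y = (\<Sum>j\<in>F. partial_deriv i (f j) y)"
proof -
  have "((\<lambda>y. \<Sum>j\<in>F. f j y) has_derivative (\<lambda>v. \<Sum>j\<in>F. frechet_derivative (f j) (at y) v)) (at y)"
    using assms by (intro has_derivative_sum) (simp add: frechet_derivative_works[symmetric])
  then show ?thesis
    unfolding partial_deriv_def by (simp add: frechet_derivative_at[symmetric])
qed

lemma divergence_form_expand:
  fixes A :: "real^'n \<Rightarrow> real^'n^'n" and h :: "real^'n \<Rightarrow> real"
  assumes "\<And>i j. C_k_on (Suc 0) V (\<lambda>y. A y $ i $ j)" "C_k_on (Suc (Suc 0)) V h" "y \<in> V"
  shows "divergence_form A h y = (\<Sum>i\<in>UNIV. \<Sum>j\<in>UNIV.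
    A y $ i $ j * partial_deriv i (partial_deriv j h) y + partial_deriv i (\<lambda>y. A y $ i $ j) y * partial_deriv j h y)"
proof -
  have d: "(\<lambda>y. A y $ i $ j) differentiable (at y)" "partial_deriv j h differentiable (at y)" for i j
    using assms(1,3) C1_partial_deriv[OF assms(2)] by auto
  show ?thesis
    unfolding divergence_form_def
    by (intro sum.cong refl, subst partial_deriv_sum)
      (use d in \<open>auto intro!: differentiable_scaleR sum.cong simp: partial_deriv_bilinear[OF bounded_bilinear_mult]\<close>)
qed

text \<open>The constant is uniform in centre and radius: it comes from the maximum over
  \<open>K\<close> of the coefficients and their first derivatives, and the bump enters only through
  the factor 30 / s^2.\<close>

lemma divergence_form_bump_bound:
  fixes A :: "real^'n \<Rightarrow> real^'n^'n"
  assumes K: "compact K" "K \<subseteq> V" and A: "\<And>i j. C_k_on (Suc 0) V (\<lambda>y. A y $ i $ j)"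
  shows "\<exists>C>0. \<forall>c s y. 0 < s \<longrightarrow> s \<le> 1 \<longrightarrow> y \<in> K \<longrightarrow> \<bar>divergence_form A (bump c s) y\<bar> \<le> C / s\<^sup>2"
proof -
  define T where "T = (\<lambda>y. \<Sum>i\<in>UNIV. \<Sum>j\<in>UNIV. \<bar>A y $ i $ j\<bar> + \<bar>partial_deriv i (\<lambda>y. A y $ i $ j) y\<bar>)"
  have "continuous_on K T"
    unfolding T_def partial_deriv_def
    by (intro continuous_on_subset[OF _ K(2)] continuous_intros C1_imp_continuous_on C1_continuous_derivative A)
  then have "bounded (T ` K)"
    by (intro compact_imp_bounded compact_continuous_image K(1))
  then obtain B where B: "B > 0" "\<forall>z\<in>T ` K. norm z \<le> B"
    unfolding bounded_pos by blast
  have "\<bar>divergence_form A (bump c s) y\<bar> \<le> 30 * B / s\<^sup>2" if s: "0 < s" "s \<le> 1" and y: "y \<in> K" for c s y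
  proof -
    note pb = partial_deriv_bump_bound[OF s]
    have "\<bar>divergence_form A (bump c s) y\<bar> \<le> (\<Sum>i\<in>UNIV. \<Sum>j\<in>UNIV.
        (\<bar>A y $ i $ j\<bar> + \<bar>partial_deriv i (\<lambda>y. A y $ i $ j) y\<bar>) * (30 / s\<^sup>2))"
      unfolding divergence_form_expand[OF A C2_bump subsetD[OF K(2) y]]
    proof (intro order.trans[OF sum_abs] sum_mono)
      fix i j
      show "\<bar>A y $ i $ j * partial_deriv i (partial_deriv j (bump c s)) y
          + partial_deriv i (\<lambda>y. A y $ i $ j) y * partial_deriv j (bump c s) y\<bar>
          \<le> (\<bar>A y $ i $ j\<bar> + \<bar>partial_deriv i (\<lambda>y. A y $ i $ j) y\<bar>) * (30 / s\<^sup>2)"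
        unfolding distrib_right
        by (intro order.trans[OF abs_triangle_ineq] add_mono) (unfold abs_mult, (intro mult_left_mono pb abs_ge_zero)+)
    qed
    also have "\<dots> = T y * (30 / s\<^sup>2)"
      by (simp only: T_def sum_distrib_right)
    also have "\<dots> \<le> B * (30 / s\<^sup>2)"
      using B(2) y by (intro mult_right_mono) force+
    finally show ?thesis by (simp add: mult.commute)
  qed
  with B(1) show ?thesis by (intro exI[of _ "30 * B"]) auto
qed

section \<open>Bumps on the manifold and the eigenvalue count\<close>

context riemannian_manifold
begin

abbreviation chart_bump :: "('a, 'n) chart \<Rightarrow> real^'n \<Rightarrow> real \<Rightarrow> 'a \<Rightarrow> complex"
  where "chart_bump c y0 s \<equiv> extend_by_zero c (\<lambda>y. complex_of_real (bump y0 s y))"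

abbreviation laplace_bump :: "('a, 'n) chart \<Rightarrow> real^'n \<Rightarrow> real \<Rightarrow> 'a \<Rightarrow> complex"
  where "laplace_bump c y0 s \<equiv> extend_by_zero c (\<lambda>y. complex_of_real
      (divergence_form (laplace_coeff g c) (bump y0 s) y / volume_density g c y))"

lemma extend_by_zero_L2:
  assumes c: "c \<in> A" and K: "compact K" "K \<subseteq> snd c ` fst c"
    and h: "continuous_on K h" "\<And>y. y \<notin> K \<Longrightarrow> h y = (0::real)"
  shows "extend_by_zero c (\<lambda>y. complex_of_real (h y)) \<in> L2 \<mu>"
    and "integrable lborel (\<lambda>y. volume_density g c y * (h y)\<^sup>2)"
    and "(\<integral>x. (cmod (extend_by_zero c (\<lambda>y. complex_of_real (h y)) x))\<^sup>2 \<partial>\<mu>)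
       = (\<integral>y. volume_density g c y * (h y)\<^sup>2 \<partial>lborel)"
proof -
  let ?f = "extend_by_zero c (\<lambda>y. complex_of_real (h y))"
  have sq: "(\<lambda>x. (cmod (?f x))\<^sup>2) = extend_by_zero c (\<lambda>y. (h y)\<^sup>2)"
    by (auto simp: extend_by_zero_def)
  have m: "(\<lambda>y. complex_of_real (h y)) \<in> borel_measurable borel" "(\<lambda>y. (h y)\<^sup>2) \<in> borel_measurable borel"
    using h by (auto intro!: measurable_compact_support[OF K(1)] continuous_intros)
  have "continuous_on K (\<lambda>y. volume_density g c y * (h y)\<^sup>2)"
    by (intro continuous_intros h(1) continuous_on_subset[OF C1_imp_continuous_on[OF C1_volume_density[OF c]] K(2)])
  then show int: "integrable lborel (\<lambda>y. volume_density g c y * (h y)\<^sup>2)"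
    by (rule integrable_compact_support[OF K(1)]) (simp add: h(2))
  have "?f \<in> borel_measurable \<mu>"
    using h(2) K(2) by (intro extend_by_zero_integral(1)[OF c m(1)]) auto
  moreover have "integrable \<mu> (extend_by_zero c (\<lambda>y. (h y)\<^sup>2))"
    using h(2) K(2) int by (subst extend_by_zero_integral(2)[OF c m(2)]) auto
  ultimately show "?f \<in> L2 \<mu>"
    by (simp add: L2_def sq)
  show "(\<integral>x. (cmod (?f x))\<^sup>2 \<partial>\<mu>) = (\<integral>y. volume_density g c y * (h y)\<^sup>2 \<partial>lborel)"
    unfolding sq using h(2) K(2) by (subst extend_by_zero_integral(3)[OF c m(2)]) auto
qed

text \<open>Two concentric balls are compared: the bump is bounded below on the ball of radius s/2,
  its Laplacian is O(s^-2) on the ball of radius s, and the volume density lies between positive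
  constants on \<open>K\<close>. The volumes of the balls have a fixed ratio, so only s^-4 is
  left.\<close>

lemma bump_estimates:
  assumes c: "c \<in> A" and K: "compact K" "K \<subseteq> snd c ` fst c" "K \<noteq> {}"
  shows "\<exists>C>0. \<forall>y0 s. 0 < s \<longrightarrow> s \<le> 1 \<longrightarrow> cball y0 s \<subseteq> K \<longrightarrow>
      chart_bump c y0 s \<in> L2 \<mu> \<and> laplace_bump c y0 s \<in> L2 \<mu> \<and>
      0 < (\<integral>x. (cmod (chart_bump c y0 s x))\<^sup>2 \<partial>\<mu>) \<and>
      (\<integral>x. (cmod (laplace_bump c y0 s x))\<^sup>2 \<partial>\<mu>) \<le> C / s ^ 4 * (\<integral>x. (cmod (chart_bump c y0 s x))\<^sup>2 \<partial>\<mu>)"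
proof -
  let ?w = "volume_density g c" and ?V = "snd c ` fst c" and ?n = "DIM(real^'n)"
  let ?D = "divergence_form (laplace_coeff g c)"
  have contw: "continuous_on K ?w"
    by (rule continuous_on_subset[OF C1_imp_continuous_on[OF C1_volume_density[OF c]] K(2)])
  obtain w1 where w1: "\<And>y. y \<in> K \<Longrightarrow> ?w y \<le> w1"
    using continuous_attains_sup[OF K(1,3) contw] by blast
  obtain ym where ym: "ym \<in> K" "\<And>y. y \<in> K \<Longrightarrow> ?w ym \<le> ?w y"
    using continuous_attains_inf[OF K(1,3) contw] by blast
  define w0 where "w0 = ?w ym"
  have w0: "w0 > 0" "\<And>y. y \<in> K \<Longrightarrow> w0 \<le> ?w y"
    unfolding w0_def using ym volume_density_pos[OF c] K(2) by auto
  have w1pos: "w1 > 0"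
    using w1[OF ym(1)] w0(1) by (simp add: w0_def)
  obtain B where B: "B > 0" "\<And>y0 s y. 0 < s \<Longrightarrow> s \<le> 1 \<Longrightarrow> y \<in> K \<Longrightarrow> \<bar>?D (bump y0 s) y\<bar> \<le> B / s\<^sup>2"
    using divergence_form_bump_bound[OF K(1,2) C1_laplace_coeff[OF c]] by blast
  define \<kappa> :: real where "\<kappa> = (27 / 64)\<^sup>2"
  \<comment> \<open>Quotient of the upper bound \<open>w1 * (B / w0 / s^2)^2 * 2 ^ ?n * v\<close>
    and the lower bound \<open>w0 * \<kappa> * v\<close>, without its factor s^-4; v is the volume
    of the half ball.\<close>
  define C where "C = w1 * (B / w0)\<^sup>2 * 2 ^ ?n / (w0 * \<kappa>)"
  have "C > 0"
    using w1pos w0(1) B(1) by (simp add: C_def \<kappa>_def)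
  moreover have "chart_bump c y0 s \<in> L2 \<mu> \<and> laplace_bump c y0 s \<in> L2 \<mu> \<and>
      0 < (\<integral>x. (cmod (chart_bump c y0 s x))\<^sup>2 \<partial>\<mu>) \<and>
      (\<integral>x. (cmod (laplace_bump c y0 s x))\<^sup>2 \<partial>\<mu>) \<le> C / s ^ 4 * (\<integral>x. (cmod (chart_bump c y0 s x))\<^sup>2 \<partial>\<mu>)"
    if s: "0 < s" "s \<le> 1" and sub: "cball y0 s \<subseteq> K" for y0 s
  proof -
    let ?K = "cball y0 s" and ?l = "\<lambda>y. ?D (bump y0 s) y / ?w y"
    note K' = compact_cball[of y0 s] subset_trans[OF sub K(2)]
    have b0: "bump y0 s y = 0" if "y \<notin> ?K" for y
      using that bump_support[OF s(1), of y y0] by auto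
    have D0: "?D (bump y0 s) y = 0" if "y \<notin> ?K" for y
      using divergence_form_support(2)[OF closed_cball b0 that] by simp
    have wpos: "0 < ?w y" if "y \<in> ?K" for y
      using w0 sub that by force
    have contb: "continuous_on ?K (bump y0 s)"
      by (rule C1_imp_continuous_on[OF C2_imp_C1[OF C2_bump]])
    have b: "chart_bump c y0 s \<in> L2 \<mu>" "integrable lborel (\<lambda>y. ?w y * (bump y0 s y)\<^sup>2)"
      "(\<integral>x. (cmod (chart_bump c y0 s x))\<^sup>2 \<partial>\<mu>) = (\<integral>y. ?w y * (bump y0 s y)\<^sup>2 \<partial>lborel)"
      by (rule extend_by_zero_L2[OF c K' contb], erule b0)+
    have l0: "?l y = 0" if "y \<notin> ?K" for y
      using D0[OF that] by simp
    have contl: "continuous_on ?K ?l"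
      using wpos by (intro continuous_on_divide continuous_on_subset[OF contw sub]
          continuous_on_subset[OF continuous_on_divergence_form[OF C1_laplace_coeff[OF c] C2_bump] K'(2)]) force
    have l: "laplace_bump c y0 s \<in> L2 \<mu>" "integrable lborel (\<lambda>y. ?w y * (?l y)\<^sup>2)"
      "(\<integral>x. (cmod (laplace_bump c y0 s x))\<^sup>2 \<partial>\<mu>) = (\<integral>y. ?w y * (?l y)\<^sup>2 \<partial>lborel)"
      by (rule extend_by_zero_L2[OF c K' contl], erule l0)+
    define v where "v = measure lborel (ball y0 (s / 2))"
    have v: "v > 0" "measure lborel ?K = 2 ^ ?n * v"
      using s(1) by (simp_all add: v_def content_ball content_cball power_divide content_ball_pos)
    have fin: "emeasure lborel ?K < \<infinity>" "emeasure lborel (ball y0 (s/2)) < \<infinity>"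
      by (rule emeasure_bounded_finite; simp)+
    have lower: "w0 * \<kappa> * v \<le> (\<integral>y. ?w y * (bump y0 s y)\<^sup>2 \<partial>lborel)"
    proof -
      have "w0 * \<kappa> * v = (\<integral>y. w0 * \<kappa> * indicator (ball y0 (s / 2)) y \<partial>lborel)"
        using fin by (simp add: v_def)
      also have "\<dots> \<le> (\<integral>y. ?w y * (bump y0 s y)\<^sup>2 \<partial>lborel)"
      proof (rule integral_mono[OF _ b(2)])
        show "integrable lborel (\<lambda>y. w0 * \<kappa> * indicat_real (ball y0 (s / 2)) y)"
          using fin by (intro integrable_mult_right integrable_real_indicator) auto
        show "w0 * \<kappa> * indicat_real (ball y0 (s / 2)) y \<le> ?w y * (bump y0 s y)\<^sup>2" for y
        proof (cases "y \<in> ball y0 (s / 2)")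
          case True
          then have "y \<in> ?K" using s by auto
          moreover have "\<kappa> \<le> (bump y0 s y)\<^sup>2"
            unfolding \<kappa>_def using bump_ge[OF s(1) True] by (intro power_mono) auto
          ultimately show ?thesis
            using True w0 sub by (auto intro!: mult_mono simp: \<kappa>_def less_imp_le[OF wpos])
        next
          case False
          have "0 \<le> ?w y * (bump y0 s y)\<^sup>2"
            using wpos[of y] b0[of y] by (cases "y \<in> ?K") auto
          then show ?thesis using False by simp
        qed
      qed
      finally show ?thesis .
    qed
    have "(\<integral>y. ?w y * (?l y)\<^sup>2 \<partial>lborel) \<le> (\<integral>y. w1 * (B / w0 / s\<^sup>2)\<^sup>2 * indicator ?K y \<partial>lborel)"
    proof (rule integral_mono[OF l(2)])
      show "integrable lborel (\<lambda>y. w1 * (B / w0 / s\<^sup>2)\<^sup>2 * indicat_real ?K y)"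
        using fin by (intro integrable_mult_right integrable_real_indicator) auto
      show "?w y * (?l y)\<^sup>2 \<le> w1 * (B / w0 / s\<^sup>2)\<^sup>2 * indicat_real ?K y" for y
      proof (cases "y \<in> ?K")
        case True
        then have y: "y \<in> K" using sub by auto
        have "\<bar>?l y\<bar> = \<bar>?D (bump y0 s) y\<bar> / ?w y"
          using wpos[OF True] by simp
        also have "\<dots> \<le> (B / s\<^sup>2) / w0"
          using B(2)[OF s y] B(1) w0(1) w0(2)[OF y] s(1) by (intro frac_le) auto
        also have "\<dots> = B / w0 / s\<^sup>2" by simp
        finally have "\<bar>?l y\<bar>\<^sup>2 \<le> (B / w0 / s\<^sup>2)\<^sup>2"
          by (intro power_mono) auto
        then have "(?l y)\<^sup>2 \<le> (B / w0 / s\<^sup>2)\<^sup>2"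
          by (simp only: power2_abs)
        then have "?w y * (?l y)\<^sup>2 \<le> w1 * (B / w0 / s\<^sup>2)\<^sup>2"
          using w1[OF y] w1pos by (intro mult_mono) auto
        then show ?thesis using True by simp
      qed (simp add: D0)
    qed
    also have "\<dots> = w1 * (B / w0 / s\<^sup>2)\<^sup>2 * (2 ^ ?n * v)"
      using fin v(2) by (simp del: content_cball)
    also have "\<dots> = C / s ^ 4 * (w0 * \<kappa> * v)"
      using w0(1) by (simp add: C_def \<kappa>_def field_simps power2_eq_square eval_nat_numeral)
    also have "\<dots> \<le> C / s ^ 4 * (\<integral>y. ?w y * (bump y0 s y)\<^sup>2 \<partial>lborel)"
      using lower \<open>C > 0\<close> s(1) by (intro mult_left_mono) auto
    finally have "(\<integral>y. ?w y * (?l y)\<^sup>2 \<partial>lborel) \<le> C / s ^ 4 * (\<integral>y. ?w y * (bump y0 s y)\<^sup>2 \<partial>lborel)" .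
    moreover have "0 < (\<integral>y. ?w y * (bump y0 s y)\<^sup>2 \<partial>lborel)"
    proof -
      have "0 < w0 * \<kappa> * v"
        using v(1) w0(1) by (simp add: \<kappa>_def)
      with lower show ?thesis by linarith
    qed
    ultimately show ?thesis
      unfolding b(3) l(3) using b(1) l(1) by blast
  qed
  ultimately show ?thesis by blast
qed

text \<open>The definition of a manifold admits the empty space and charts with empty domain; a
  vector of norm one rules out that all charts are of this kind.\<close>

lemma chart_nonempty:
  assumes "orthonormal_system \<mu> UNIV (e :: nat \<Rightarrow> 'a \<Rightarrow> complex)"
  shows "\<exists>c\<in>A. fst c \<noteq> {}"
proof (rule ccontr)
  assume "\<not> (\<exists>c\<in>A. fst c \<noteq> {})"
  moreover have "(\<Union>c\<in>A. fst c) = topspace X"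
    using manifold by (simp add: compact_smooth_manifold_def smooth_atlas_def)
  ultimately have "space \<mu> = {}"
    by (simp add: space_volume)
  then have "L2_inner \<mu> (e 0) (e 0) = 0"
    unfolding L2_inner_def by (intro integral_eq_zero_AE) auto
  then show False
    using assms by (simp add: orthonormal_system_def)
qed

text \<open>\<open>M\<close> is the number of grid points per coordinate, so the bumps number
  exactly \<open>M ^ CARD('n)\<close> and no packing or rounding estimate enters.\<close>

lemma Weyl_lower_bound:
  assumes eig: "eigenbasis A g \<mu> e lam"
  shows "\<exists>L. \<forall>M\<ge>1. \<exists>F. finite F \<and> (\<forall>k\<in>F. lam k \<le> L * real M) \<and> real (M ^ CARD('n)) \<le> 2 * real (card F)"
proof -
  have basis: "orthonormal_basis \<mu> e"
    using eig by (simp add: eigenbasis_def)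
  then have "orthonormal_system \<mu> UNIV e"
    by (simp add: orthonormal_basis_def)
  then obtain c where c: "c \<in> A" "fst c \<noteq> {}"
    using chart_nonempty by blast
  then obtain y0 where y0: "y0 \<in> snd c ` fst c" by auto
  then obtain r where r: "r > 0" "cball y0 r \<subseteq> snd c ` fst c"
    using chart(2)[OF c(1)] open_contains_cball by blast
  define R where "R = min r 1"
  let ?K = "cball y0 R" and ?n = "real CARD('n)"
  have R: "0 < R" "R \<le> 1" "?K \<subseteq> snd c ` fst c" "?K \<noteq> {}"
    using r by (auto simp: R_def)
  obtain C where C: "C > 0" "\<And>z s. 0 < s \<Longrightarrow> s \<le> 1 \<Longrightarrow> cball z s \<subseteq> ?K \<Longrightarrow>
      chart_bump c z s \<in> L2 \<mu> \<and> laplace_bump c z s \<in> L2 \<mu> \<and>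
      0 < (\<integral>x. (cmod (chart_bump c z s x))\<^sup>2 \<partial>\<mu>) \<and>
      (\<integral>x. (cmod (laplace_bump c z s x))\<^sup>2 \<partial>\<mu>) \<le> C / s ^ 4 * (\<integral>x. (cmod (chart_bump c z s x))\<^sup>2 \<partial>\<mu>)"
    using bump_estimates[OF c(1) compact_cball R(3,4)] by blast
  \<comment> \<open>The grid sits in a cube of side R0, whose points are within
    \<open>?n * R0\<close> of the corner \<open>y0\<close> by the l^1 bound on the norm; one further
    R0 is reserved for the radius of the bumps.\<close>
  define R0 where "R0 = R / (?n + 1)"
  have R0: "R0 > 0" "R0 \<le> R"
    using R(1) by (auto simp: R0_def field_simps)
  have R0_sum: "?n * R0 + R0 = R"
  proof -
    have "?n * R0 + R0 = (?n + 1) * R0"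
      by (simp add: algebra_simps)
    also have "\<dots> = R"
    proof -
      have "?n + 1 \<noteq> 0"
        using of_nat_0_le_iff[of "CARD('n)", where 'a = real] by linarith
      then show ?thesis
        unfolding R0_def times_divide_eq_right by (rule nonzero_mult_div_cancel_left)
    qed
    finally show ?thesis .
  qed
  \<comment> \<open>With s = R0 / (2 M) the bound C / s^4 equals 64 C (M / R0)^4 / 4, and the
    counting lemma allows (L M)^4 / 4. A number at least 1 is below its fourth power, so the maximum
    with 1 spares a fourth root.\<close>
  define L where "L = max 1 (64 * C) / R0"
  have "\<exists>F. finite F \<and> (\<forall>k\<in>F. lam k \<le> L * real M) \<and> real (M ^ CARD('n)) \<le> 2 * real (card F)"
    if M: "M \<ge> 1" for M :: nat
  proof -
    define Z where "Z = (PiE UNIV (\<lambda>_. {..<M}) :: ('n \<Rightarrow> nat) set)"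
    define p where "p = (\<lambda>z :: 'n \<Rightarrow> nat. y0 + (\<chi> i. R0 / real M * real (z i)))"
    \<comment> \<open>Half the grid spacing: distinct centres are at least 2 s apart, so the open
      balls off which the bumps vanish are disjoint.\<close>
    define s where "s = R0 / (2 * real M)"
    have s: "0 < s" "s \<le> R0" "s \<le> 1" "R0 / real M = 2 * s"
    proof -
      show "0 < s" "R0 / real M = 2 * s"
        using R0 M by (auto simp: s_def)
      have "R0 * 1 \<le> R0 * (2 * real M)"
        using R0 M by (intro mult_left_mono) auto
      then show "s \<le> R0"
        using M by (simp add: s_def divide_le_eq)
      then show "s \<le> 1"
        using R0 R by linarith
    qed
    have Z: "finite Z" "card Z = M ^ CARD('n)"
      by (simp_all add: Z_def finite_PiE card_PiE)
    have sub: "cball (p z) s \<subseteq> ?K" if "z \<in> Z" for z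
    proof
      fix y assume y: "y \<in> cball (p z) s"
      have "norm (p z - y0) \<le> (\<Sum>i\<in>UNIV. \<bar>(p z - y0) $ i\<bar>)"
        by (rule norm_le_l1_cart)
      also have "\<dots> \<le> (\<Sum>i\<in>(UNIV :: 'n set). R0)"
      proof (rule sum_mono)
        fix i
        have "z i < M" using that by (auto simp: Z_def)
        then have "R0 * real (z i) \<le> R0 * real M"
          using R0 by (intro mult_left_mono) auto
        then show "\<bar>(p z - y0) $ i\<bar> \<le> R0"
          using R0 M by (simp add: p_def divide_le_eq)
      qed
      finally have "norm (p z - y0) \<le> ?n * R0" by simp
      moreover have "norm (y - p z) \<le> s"
        using y by (simp add: dist_norm norm_minus_commute)
      ultimately have "norm (y - y0) \<le> R"
        using norm_triangle_ineq[of "y - p z" "p z - y0"] s(2) R0_sum by simp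
      then show "y \<in> ?K"
        by (simp add: dist_norm norm_minus_commute)
    qed
    define b where "b = (\<lambda>z. chart_bump c (p z) s)"
    define D where "D = (\<lambda>z. laplace_bump c (p z) s)"
    define \<beta> where "\<beta> = (\<lambda>z. \<integral>x. (cmod (b z x))\<^sup>2 \<partial>\<mu>)"
    have bD: "b z \<in> L2 \<mu>" "D z \<in> L2 \<mu>" "0 < \<beta> z" "(\<integral>x. (cmod (D z x))\<^sup>2 \<partial>\<mu>) \<le> C / s ^ 4 * \<beta> z" if "z \<in> Z" for z
      using C(2)[OF s(1,3) sub[OF that]] by (auto simp: b_def D_def \<beta>_def)
    have disjoint: "b z x * cnj (b z' x) = 0" if "z \<noteq> z'" for z z' x
    proof -
      obtain i where i: "z i \<noteq> z' i" using \<open>z \<noteq> z'\<close> by auto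
      have "2 * s * 1 \<le> 2 * s * \<bar>real (z i) - real (z' i)\<bar>"
        using s(1) i by (intro mult_left_mono) auto
      also have "\<dots> = \<bar>(p z - p z') $ i\<bar>"
        using s(1) unfolding p_def s(4) by (simp add: abs_mult flip: right_diff_distrib)
      also have "\<dots> \<le> norm (p z - p z')"
        by (rule component_le_norm_cart)
      finally have far: "2 * s \<le> dist (p z) (p z')"
        by (simp add: dist_norm)
      have "bump (p z) s y = 0 \<or> bump (p z') s y = 0" for y
      proof (rule ccontr)
        assume "\<not> ?thesis"
        then have "y \<in> ball (p z) s" "y \<in> ball (p z') s"
          using bump_support[OF s(1)] by blast+
        then show False
          using far dist_triangle[of "p z" "p z'" y] by (simp add: dist_commute)
      qed
      then show ?thesis
        by (auto simp: b_def extend_by_zero_def)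
    qed
    define a where "a = (\<lambda>z. complex_of_real (1 / sqrt (\<beta> z)))"
    have a: "cmod (a z) ^ 2 * \<beta> z = 1" if "z \<in> Z" for z
      using bD(3)[OF that] by (simp add: a_def norm_divide power_divide)
    have "orthonormal_system \<mu> Z (\<lambda>z x. a z * b z x)"
      unfolding orthonormal_system_def
    proof (intro conjI ballI)
      show "(\<lambda>x. a z * b z x) \<in> L2 \<mu>" if "z \<in> Z" for z
        by (intro L2_cmult bD(1) that)
      show "L2_inner \<mu> (\<lambda>x. a z * b z x) (\<lambda>x. a z' * b z' x) = (if z = z' then 1 else 0)"
        if "z \<in> Z" "z' \<in> Z" for z z'
      proof (cases "z = z'")
        case True
        have "L2_inner \<mu> (\<lambda>x. a z * b z x) (\<lambda>x. a z * b z x) = of_real (cmod (a z) ^ 2 * \<beta> z)"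
          unfolding L2_inner_self \<beta>_def by (simp add: norm_mult power_mult_distrib)
        then show ?thesis
          using True a[OF that(1)] by (simp only: of_real_1 if_True simp_thms)
      next
        case False
        have "(\<lambda>x. a z * b z x * cnj (a z' * b z' x)) = (\<lambda>x. 0)"
        proof
          show "a z * b z x * cnj (a z' * b z' x) = 0" for x
            using disjoint[OF False, of x] by auto
        qed
        then show ?thesis
          using False unfolding L2_inner_def by simp
      qed
    qed
    moreover have "(\<lambda>x. a z * D z x) \<in> L2 \<mu>" if "z \<in> Z" for z
      by (intro L2_cmult bD(2) that)
    moreover have "cmod (L2_inner \<mu> (\<lambda>x. a z * D z x) (e k)) = (lam k)\<^sup>2 * cmod (L2_inner \<mu> (\<lambda>x. a z * b z x) (e k))"
      if "z \<in> Z" for z k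
    proof -
      have "L2_inner \<mu> (D z) (e k) = - of_real ((lam k)\<^sup>2) * L2_inner \<mu> (b z) (e k)"
        unfolding D_def b_def
      proof (rule laplacian_eigenfunction_inner[OF c(1) compact_cball[of "p z" s] _ C2_bump])
        show "cball (p z) s \<subseteq> snd c ` fst c"
          using sub[OF that] R(3) by auto
        show "bump (p z) s y = 0" if "y \<notin> cball (p z) s" for y
          using that bump_support[OF s(1), of y "p z"] by auto
        show "smooth_fun A (e k)" "\<And>x. x \<in> fst c \<Longrightarrow> - laplace_beltrami g c (e k) x = of_real ((lam k)\<^sup>2) * e k x"
          using eig c(1) by (auto simp: eigenbasis_def)
      qed
      then show ?thesis
        by (simp add: L2_inner_cmult norm_mult norm_power)
    qed
    moreover have "(\<integral>x. (cmod (a z * D z x))\<^sup>2 \<partial>\<mu>) \<le> (L * real M) ^ 4 / 4" if "z \<in> Z" for z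
    proof -
      have "(\<integral>x. (cmod (a z * D z x))\<^sup>2 \<partial>\<mu>) = cmod (a z) ^ 2 * (\<integral>x. (cmod (D z x))\<^sup>2 \<partial>\<mu>)"
        by (simp add: norm_mult power_mult_distrib)
      also have "\<dots> \<le> cmod (a z) ^ 2 * (C / s ^ 4 * \<beta> z)"
        by (intro mult_left_mono bD(4) that) auto
      also have "\<dots> = C / s ^ 4 * (cmod (a z) ^ 2 * \<beta> z)"
        by (simp only: mult_ac)
      also have "\<dots> = 64 * C * (real M / R0) ^ 4 / 4"
        using a[OF that] by (simp add: s_def power_divide power_mult_distrib)
      also have "\<dots> \<le> max 1 (64 * C) ^ 4 * (real M / R0) ^ 4 / 4"
      proof -
        have "max 1 (64 * C) ^ 1 \<le> max 1 (64 * C) ^ 4"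
          by (intro power_increasing) auto
        then have "64 * C \<le> max 1 (64 * C) ^ 4"
          by (simp only: power_one_right)
        then show ?thesis
          by (intro divide_right_mono mult_right_mono) auto
      qed
      also have "\<dots> = (L * real M) ^ 4 / 4"
        by (simp add: L_def power_divide power_mult_distrib)
      finally show ?thesis .
    qed
    moreover have "0 < L * real M"
      using M R0 by (simp add: L_def)
    ultimately have "\<exists>F. finite F \<and> (\<forall>k\<in>F. lam k \<le> L * real M) \<and> real (card Z) \<le> 2 * real (card F)"
      by (intro eigenvalue_count_lower_bound[OF basis Z(1)])
    then show ?thesis
      unfolding Z(2) .
  qed
  then show ?thesis by blast
qed

end

theorem mainTheorem16:
  fixes X :: "'a topology"
    and A :: "('a, 'n::finite) chart set"
    and g :: "('a, 'n) chart \<Rightarrow> 'a \<Rightarrow> real^'n^'n"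
    and \<mu> :: "'a measure"
    and e :: "nat \<Rightarrow> 'a \<Rightarrow> complex"
    and lam :: "nat \<Rightarrow> real"
    and \<omega> :: "real \<Rightarrow> real"
    and p q \<beta> :: ereal
    and \<sigma> :: real
    and I :: "real set"
  assumes "compact_smooth_manifold X A"
    and "riemannian_metric A g"
    and "riemannian_volume X A g \<mu>"
    and "eigenbasis A g \<mu> e lam"
    and "dispersion_symbol \<omega>"
    and "2 \<le> p" and "2 \<le> q" and "0 < \<beta>"
    and "is_interval I" and "bounded I" and "0 < measure lborel I"
    and strichartz: "\<exists>C\<ge>0. \<forall>N\<ge>10::real. \<forall>(J :: nat set) (f :: nat \<Rightarrow> 'a \<Rightarrow> complex) (\<nu> :: nat \<Rightarrow> complex).
        orthonormal_system \<mu> J f \<longrightarrow>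
        (\<forall>j\<in>J. {k. fourier_coeff \<mu> e (f j) k \<noteq> 0} \<subseteq> {k. lam k \<le> N}) \<longrightarrow>
        ell_norm \<beta> J \<nu> < \<infinity> \<longrightarrow>
        mixed_norm (p / 2) (q / 2) I \<mu> (total_density \<mu> e lam \<omega> J \<nu> f)
          \<le> ennreal (C * measure lborel I powr real_of_ereal (2 / p) * N powr \<sigma>) * ell_norm \<beta> J \<nu>"
  shows "1 / \<beta> \<ge> ereal (1 - \<sigma> / real CARD('n))"
proof -
  interpret riemannian_manifold X A g \<mu>
    by unfold_locales (rule assms)+
  have os: "orthonormal_system \<mu> UNIV e" and "lam 0 \<le> 0"
    using \<open>eigenbasis A g \<mu> e lam\<close> by (simp_all add: eigenbasis_def orthonormal_basis_def)
  then show ?thesis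
    using test_eigenfunctions[OF os finite_volume \<open>2 \<le> p\<close> \<open>2 \<le> q\<close> \<open>0 < \<beta>\<close> \<open>0 < measure lborel I\<close> strichartz]
      Weyl_lower_bound[OF \<open>eigenbasis A g \<mu> e lam\<close>] \<open>0 < \<beta>\<close>
    by (intro exponent_bound) auto
qed

end
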